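(* Let $F$ be an $(r-1)$-graph with $r-1,|F|\ge 2$ such that $F^{(r)}$ is a spanning subgraph of a tight $r$-tree and such that there exist positive functions $M_{r-1}=M_{r-1}(n)$, $\gamma_{r-1}=\gamma_{r-1}(n)$ and $\tau_{r-1}=\tau_{r-1}(n,m)$ with the following properties: (a) $F$ is $(M_{r-1},\gamma_{r-1},\tau_{r-1})$-balanced; (b) for sufficiently large $n$ the function $\gamma_{r-1}(n)$ is non-decreasing with respect to $n$; (c) for sufficiently large $n$ and $m\ge M_{r-1}(n)$, the function $\tau_{r-1}(n,m)$ is non-decreasing with respect to $n$ and non-increasing with respect to $m$. Then there exists a sufficiently large constant $C$ depending only on $F$ such that the following holds. Let $$M_r(n):=Cn^{r-1},\qquad \gamma_r(n):=\gamma_{r-1}(n)\cdot C\log n,$$ let $A=A(n,m)$ be any function such that for all sufficiently large $n$ and $m\ge M_r(n)$, $$m\,n^{1-r}\le A(n,m)\le \frac{m}{M_{r-1}(n)\cdot C\log n},$$ and let $$\tau_r(n,m):=\max\left\{A(n,m)^{-\frac{1}{d_r(F^{(r)})}}\cdot m,\ \ \tau_{r-1}\left(n,\frac{m}{A(n,m)\cdot C\log n}\right)\cdot C\log n\right\}.$$ Then $F^{(r)}$ is $(M_r,\gamma_r,\tau_r)$-balanced.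
   Context: An $r$-graph is a finite $r$-uniform hypergraph; $v(F)$ is the number of vertices and $|F|$ the number of edges of $F$. For $|F|\ge 2$, $d_r(F)=\max_{F'\subseteq F,\ |F'|\ge 2}\frac{|F'|-1}{v(F')-r}$. For an $(r-1)$-graph $F$, the expansion $F^{(r)}$ is the $r$-graph obtained by inserting one new vertex into each edge of $F$, with distinct new vertices for distinct edges. An $r$-graph $T$ is a tight $r$-tree if its edges can be ordered as $h_1,\dots,h_t$ so that for every $i\ge 2$ there exist $v\in h_i$ and $1\le s\le i-1$ with $v\notin\bigcup_{j=1}^{i-1}h_j$ and $h_i\setminus\{v\}\subset h_s$. A spanning subgraph of $T$ is a subgraph with vertex set $V(T)$. For a hypergraph $\mathcal{H}$ and $S\subseteq V(\mathcal{H})$, $\deg_{\mathcal{H}}(S)$ is the number of edges of $\mathcal{H}$ containing $S$, and $\Delta_i(\mathcal{H})=\max\{\deg_{\mathcal{H}}(S): S\subseteq V(\mathcal{H}),|S|=i\}$. Given positive functions $M=M(n)$, $\gamma=\gamma(n)$, $\tau=\tau(n,m)$ (functions of real arguments), an $r$-graph $F$ is $(M,\gamma,\tau)$-balanced if for every $n$-vertex $m$-edge $r$-graph $H$ with $n$ sufficiently large and $m\ge M(n)$, there exists a non-empty collection $\mathcal{H}$ of copies of $F$ in $H$ (viewed as an $|F|$-uniform hypergraph on vertex set $E(H)$) such that for all integers $1\le i\le |F|$, $$\Delta_i(\mathcal{H})\le \frac{\gamma(n)|\mathcal{H}|}{m}\left(\frac{\tau(n,m)}{m}\right)^{i-1}.$$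 *)

theory Defs
  imports Complex_Main
begin

record 'a hypergraph =
  hverts :: "'a set"
  hedges :: "'a set set"

definition r_graph :: "nat \<Rightarrow> 'a hypergraph \<Rightarrow> bool" where
  "r_graph r F \<longleftrightarrow> finite (hverts F) \<and> (\<forall>e\<in>hedges F. e \<subseteq> hverts F \<and> card e = r)"

definition subhypergraph :: "'a hypergraph \<Rightarrow> 'a hypergraph \<Rightarrow> bool" where
  "subhypergraph F' F \<longleftrightarrow>
     hverts F' \<subseteq> hverts F \<and> hedges F' \<subseteq> hedges F \<and> (\<forall>e\<in>hedges F'. e \<subseteq> hverts F')"

definition spanning_subhypergraph :: "'a hypergraph \<Rightarrow> 'a hypergraph \<Rightarrow> bool" where
  "spanning_subhypergraph F T \<longleftrightarrow> subhypergraph F T \<and> hverts F = hverts T"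

text \<open>The quantity $d_r(F)$. If F is an r-graph with at least two edges, the maximum is over a
  finite non-empty set and all denominators are positive.\<close>

definition r_density :: "nat \<Rightarrow> 'a hypergraph \<Rightarrow> real" where
  "r_density r F =
     Max {(real (card (hedges F')) - 1) / (real (card (hverts F')) - real r) |F'.
            subhypergraph F' F \<and> card (hedges F') \<ge> 2}"

text \<open>Original vertices are tagged by Inl; the new vertex inserted into the edge e is Inr e.\<close>

definition expansion :: "'a hypergraph \<Rightarrow> ('a + 'a set) hypergraph" where
  "expansion F =
     \<lparr>hverts = Inl ` hverts F \<union> Inr ` hedges F,
      hedges = (\<lambda>e. insert (Inr e) (Inl ` e)) ` hedges F\<rparr>"

text \<open>A tight tree has no isolated vertices: its vertex set is the union of its edges.\<close>

definition tight_tree :: "nat \<Rightarrow> 'a hypergraph \<Rightarrow> bool" where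
  "tight_tree r T \<longleftrightarrow>
     r_graph r T \<and> hverts T = \<Union> (hedges T) \<and>
     (\<exists>hs. distinct hs \<and> set hs = hedges T \<and>
        (\<forall>i. 1 \<le> i \<and> i < length hs \<longrightarrow>
          (\<exists>v\<in>hs ! i. \<exists>s<i. v \<notin> (\<Union>j<i. hs ! j) \<and> hs ! i - {v} \<subseteq> hs ! s)))"

definition set_degree :: "'a hypergraph \<Rightarrow> 'a set \<Rightarrow> nat" where
  "set_degree H S = card {e \<in> hedges H. S \<subseteq> e}"

definition max_set_degree :: "nat \<Rightarrow> 'a hypergraph \<Rightarrow> nat" where
  "max_set_degree i H = Max {set_degree H S |S. S \<subseteq> hverts H \<and> card S = i}"

text \<open>A copy of F in H is recorded by its set of edges, so that a collection of copies is the
  edge set of a hypergraph on the vertex set \<^term>\<open>hedges H\<close>.\<close>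

definition copies :: "'a hypergraph \<Rightarrow> 'b hypergraph \<Rightarrow> 'b set set set" where
  "copies F H =
     {S. \<exists>f. inj_on f (hverts F) \<and> f ` hverts F \<subseteq> hverts H \<and>
             S = (\<lambda>e. f ` e) ` hedges F \<and> S \<subseteq> hedges H}"

text \<open>Positivity is required on the range on which the functions matter, that is, for large n
  and m at least M n (a factor such as ln n is not positive at all arguments).\<close>

definition positive_parameters ::
    "(real \<Rightarrow> real) \<Rightarrow> (real \<Rightarrow> real) \<Rightarrow> (real \<Rightarrow> real \<Rightarrow> real) \<Rightarrow> bool" where
  "positive_parameters M \<gamma> \<tau> \<longleftrightarrow>
     (\<forall>\<^sub>F n in at_top. M n > 0 \<and> \<gamma> n > 0 \<and> (\<forall>m\<ge>M n. \<tau> n m > 0))"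

text \<open>The host hypergraphs H have vertices in nat; up to isomorphism these are all the finite
  hypergraphs. The maximum degrees in the bound are only evaluated for non-empty families, so
  that i is at most the number of edges of H and the maximum is over a non-empty set.\<close>

definition balanced ::
    "nat \<Rightarrow> (real \<Rightarrow> real) \<Rightarrow> (real \<Rightarrow> real) \<Rightarrow> (real \<Rightarrow> real \<Rightarrow> real)
      \<Rightarrow> 'a hypergraph \<Rightarrow> bool" where
  "balanced r M \<gamma> \<tau> F \<longleftrightarrow>
     positive_parameters M \<gamma> \<tau> \<and>
     (\<forall>\<^sub>F n in sequentially. \<forall>m. \<forall>H :: nat hypergraph.
        r_graph r H \<and> card (hverts H) = n \<and> card (hedges H) = m \<and> real m \<ge> M (real n) \<longrightarrow>
        (\<exists>\<C>. \<C> \<noteq> {} \<and> \<C> \<subseteq> copies F H \<and>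
          (\<forall>i. 1 \<le> i \<and> i \<le> card (hedges F) \<longrightarrow>
             real (max_set_degree i \<lparr>hverts = hedges H, hedges = \<C>\<rparr>)
               \<le> \<gamma> (real n) * real (card \<C>) / real m
                   * (\<tau> (real n) (real m) / real m) ^ (i - 1))))"

end

theory Submission
  imports Defs "HOL-Library.FuncSet"
begin

text \<open>
  Let \<open>H\<close> be an \<open>r\<close>-graph with \<open>n\<close> vertices and \<open>m\<close> edges, where \<open>m \<ge> C n^(r - 1)\<close>, and let
  \<open>A = A(n, m)\<close>. As long as some \<open>(r - 1)\<close>-set lies in at least one but in fewer than \<open>A\<close> of the
  remaining edges, remove the edges containing it and assign them to that set
  (\<open>codegree_cleaning\<close>). What decides the argument is whether the larger part of \<open>H\<close> is removed.

  If half of the edges are removed, the \<open>(r - 1)\<close>-sets with their assigned edges form a shadow in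
  which each set has fewer than \<open>A\<close> edges of its own. There are at most \<open>n^(r - 1)\<close> such sets, so those with
  far fewer edges than the average \<open>m / n^(r - 1)\<close> may be dropped, and at the cost of a factor
  \<open>ln n\<close> all remaining ones have about the same number \<open>D < A\<close> of edges (\<open>dyadic_shadow\<close>). This
  leaves an \<open>(r - 1)\<close>-graph with about \<open>m / (D ln n)\<close> edges, which is at least \<open>M n\<close> as \<open>D < A\<close>.
  Balancedness of \<open>F\<close> gives a family of copies of \<open>F\<close> there. Replacing every edge of a copy by one of
  its assigned edges, with new and distinct added vertices, multiplies the family by about
  \<open>D ^ |F|\<close>, and fixing \<open>i\<close> edges costs a factor \<open>D ^ i\<close>, which together with the
  factor \<open>ln n\<close> is what the second term of \<open>\<tau>\<^sub>r\<close> records (\<open>extension_family\<close>, \<open>spread_copies_from_light_shadow\<close>).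

  If half of the edges survive, every \<open>(r - 1)\<close>-set that is covered at all now has codegree at
  least \<open>A\<close>. Embed the tight tree \<open>T\<close> at random: put its first edge on a uniformly chosen edge of the
  host, and then choose every further vertex uniformly among the possible ones. The probability of an
  outcome is proportional to a product of reciprocal codegrees, one for each pair of consecutive tree
  edges, and this product does not depend on the edge at which the tree is rooted. Rooting at an
  edge of \<open>T\<close> whose image is prescribed, one sees that prescribing the images of a vertex set \<open>U\<close>
  leaves weight at most \<open>A ^ - (|U| - r)\<close> (\<open>rooted_walk_weight_le\<close>), whatever the codegrees above
  \<open>A\<close> are. The injective outcomes keep a positive proportion of the total weight
  (\<open>injective_walk_weight_ge\<close>). As \<open>T\<close> and the expansion have the same vertices, every injective outcome
  gives a copy of the expansion. The induced weights of copies lie between two powers of \<open>n\<close>, so the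
  copies whose weight lies in a suitable dyadic interval carry a proportion \<open>1 / ln n\<close> of it; counting
  them instead of weighing them gives the required family (\<open>near_uniform_subfamily\<close>,
  \<open>spread_family_of_copies\<close>). By definition of the density \<open>d\<close>, \<open>i\<close> edges of the expansion span at
  least \<open>r + (i - 1) / d\<close> vertices, and so the bound becomes the first term of \<open>\<tau>\<^sub>r\<close>
  (\<open>power_span_le_density\<close>).

  The second case loses a factor \<open>ln n\<close> without gaining \<open>\<gamma>\<close>. This is harmless because \<open>\<gamma> n \<ge> 1\<close> for
  large \<open>n\<close>: the hypothesis on \<open>A\<close> forces \<open>M n\<close> to be at most the number of edges of the complete
  \<open>(r - 1)\<close>-graph (\<open>complete_r_graph\<close>), and there the maximum degree is at least the average
  degree (\<open>degree_factor_ge_1\<close>).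
\<close>

section \<open>Dyadic selection\<close>

lemma sum_UN_le:
  fixes f :: "'b \<Rightarrow> real"
  assumes "finite J" "\<And>j. j \<in> J \<Longrightarrow> finite (B j)" "\<And>x. 0 \<le> f x"
  shows "sum f (\<Union>j\<in>J. B j) \<le> (\<Sum>j\<in>J. sum f (B j))"
  using assms(1,2)
proof (induction J rule: finite_induct)
  case (insert j J)
  have "sum f (B j \<union> (\<Union>j\<in>J. B j)) \<le> sum f (B j) + sum f (\<Union>j\<in>J. B j)"
    using insert assms(3) by (simp add: sum_Un sum_nonneg)
  with insert show ?case by force
qed simp

text \<open>
  The values of \<open>w\<close> fall into \<open>N\<close> intervals with end points in ratio 2, so one of the intervals
  receives at least the average share of the total.
\<close>

lemma dyadic_class:
  fixes w :: "'b \<Rightarrow> real"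
  assumes "finite X" "X \<noteq> {}" "0 < a" and bnd: "\<And>x. x \<in> X \<Longrightarrow> a \<le> w x \<and> w x < 2 ^ N * a"
  obtains k where "sum w X \<le> real N * sum w {x \<in> X. 2 ^ k * a \<le> w x \<and> w x < 2 * (2 ^ k * a)}"
proof -
  let ?X = "\<lambda>k. {x \<in> X. 2 ^ k * a \<le> w x \<and> w x < 2 * (2 ^ k * a)}"
  have cover: "X \<subseteq> (\<Union>k<N. ?X k)"
  proof
    fix x assume x: "x \<in> X"
    define k where "k = (LEAST k. w x < 2 ^ k * a)"
    have k1: "w x < 2 ^ k * a" unfolding k_def by (rule LeastI[of _ N]) (use bnd x in blast)
    have kN: "k \<le> N" unfolding k_def by (rule Least_le) (use bnd x in blast)
    have "k \<noteq> 0" using k1 bnd[OF x] by (intro notI) simp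
    then obtain j where j: "k = Suc j" by (cases k) auto
    have "\<not> w x < 2 ^ j * a" using not_less_Least[of j "\<lambda>k. w x < 2 ^ k * a"] j k_def by simp
    then have "x \<in> ?X j" using k1 j x by (simp add: algebra_simps)
    moreover have "j < N" using j kN by simp
    ultimately show "x \<in> (\<Union>k<N. ?X k)" by blast
  qed
  have w0: "0 \<le> w x" if "x \<in> X" for x using bnd[OF that] \<open>0 < a\<close> by linarith
  have "N > 0" using cover \<open>X \<noteq> {}\<close> by (cases N) auto
  have "\<exists>k<N. sum w X \<le> real N * sum w (?X k)"
  proof (rule ccontr)
    assume "\<not> ?thesis"
    then have less: "real N * sum w (?X k) < sum w X" if "k < N" for k using that by force
    have "sum w X = sum (\<lambda>x. max 0 (w x)) X" using w0 by (intro sum.cong) auto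
    also have "\<dots> \<le> sum (\<lambda>x. max 0 (w x)) (\<Union>k<N. ?X k)"
      using cover assms(1) by (intro sum_mono2) auto
    also have "\<dots> \<le> (\<Sum>k<N. sum (\<lambda>x. max 0 (w x)) (?X k))"
      using assms(1) by (intro sum_UN_le) auto
    also have "\<dots> = (\<Sum>k<N. sum w (?X k))"
      using w0 by (intro sum.cong) auto
    finally have "real N * sum w X \<le> (\<Sum>k<N. real N * sum w (?X k))"
      by (simp add: sum_distrib_left[symmetric] mult_left_mono)
    also have "\<dots> < (\<Sum>k<N. sum w X)"
      using less \<open>N > 0\<close> by (intro sum_strict_mono) auto
    finally show False by simp
  qed
  with that show thesis by blast
qed

text \<open>
  Passage from weights to counting: in a dyadic class all weights agree up to a factor 2, so
  the proportion of its members with any property \<open>Q\<close> is controlled by the weight of \<open>Q\<close>. The class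
  does not depend on \<open>Q\<close>, which is why \<open>Q\<close> is quantified inside the conclusion.
\<close>

lemma near_uniform_subfamily:
  fixes w :: "'b \<Rightarrow> real"
  assumes "finite X" "X \<noteq> {}" "0 < a" and bnd: "\<And>x. x \<in> X \<Longrightarrow> a \<le> w x \<and> w x < 2 ^ N * a"
  obtains Y where "Y \<subseteq> X" "Y \<noteq> {}"
    "\<And>Q. real (card {x \<in> Y. Q x}) * sum w X \<le> 2 * real N * real (card Y) * sum w {x \<in> X. Q x}"
proof -
  obtain k where k: "sum w X \<le> real N * sum w {x \<in> X. 2 ^ k * a \<le> w x \<and> w x < 2 * (2 ^ k * a)}"
    using dyadic_class[where w = w and N = N, OF assms(1-3) bnd] by blast
  define b where "b = 2 ^ k * a"
  define Y where "Y = {x \<in> X. b \<le> w x \<and> w x < 2 * b}"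
  have b0: "b > 0" using \<open>0 < a\<close> by (simp add: b_def)
  have kY: "sum w X \<le> real N * sum w Y" using k by (simp add: Y_def b_def)
  have w0: "0 < w x" if "x \<in> X" for x using bnd[OF that] \<open>0 < a\<close> by linarith
  have "0 < sum w X" using assms w0 by (intro sum_pos) auto
  with kY have "Y \<noteq> {}" by (intro notI) simp
  moreover have "Y \<subseteq> X" by (auto simp: Y_def)
  moreover have "real (card {x \<in> Y. Q x}) * sum w X \<le> 2 * real N * real (card Y) * sum w {x \<in> X. Q x}" for Q
  proof -
    have "sum w Y \<le> real (card Y) * (2 * b)"
      by (rule sum_bounded_above) (auto simp: Y_def)
    then have 1: "sum w X \<le> real N * (real (card Y) * (2 * b))"
      using kY mult_left_mono[of "sum w Y" "real (card Y) * (2 * b)" "real N"] by linarith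
    have "real (card {x \<in> Y. Q x}) * b \<le> sum w {x \<in> Y. Q x}"
      by (rule sum_bounded_below) (auto simp: Y_def)
    also have "\<dots> \<le> sum w {x \<in> X. Q x}"
      using assms(1) w0 by (intro sum_mono2) (auto simp: Y_def less_imp_le)
    finally have 2: "real (card {x \<in> Y. Q x}) * b \<le> sum w {x \<in> X. Q x}" .
    have "real (card {x \<in> Y. Q x}) * sum w X
        \<le> real (card {x \<in> Y. Q x}) * (real N * (real (card Y) * (2 * b)))"
      using 1 by (rule mult_left_mono) simp
    also have "\<dots> = (2 * real N * real (card Y)) * (real (card {x \<in> Y. Q x}) * b)" by simp
    also have "\<dots> \<le> (2 * real N * real (card Y)) * sum w {x \<in> X. Q x}"
      using 2 by (rule mult_left_mono) simp
    finally show ?thesis .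
  qed
  ultimately show thesis using that by blast
qed

text \<open>
  For weights between two powers of \<open>n\<close> the number of dyadic intervals is \<open>O(ln n)\<close>.
\<close>

lemma power_less_two_power_log:
  assumes "n \<ge> 3"
  obtains N where "real n ^ q < 2 ^ N" "real N \<le> (2 * real q + 2) * ln (real n)"
proof -
  have ln1: "ln (real n) \<ge> 1"
    using assms exp_le by (subst ln_ge_iff) (auto intro: order_trans)
  define N where "N = nat \<lceil>2 * real q * ln (real n)\<rceil> + 1"
  have N: "2 * real q * ln (real n) + 1 \<le> real N" "real N \<le> 2 * real q * ln (real n) + 2"
    using ln1 by (auto simp: N_def) linarith+
  have ln2: "1 / 2 \<le> ln (2::real)" using exp_half_le2 by (subst ln_ge_iff) auto
  have "real q * ln (real n) < real N * (1 / 2)" using N by linarith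
  also have "\<dots> \<le> real N * ln 2" using ln2 by (intro mult_left_mono) auto
  finally have "exp (real q * ln (real n)) < exp (real N * ln 2)" by simp
  then have "real n ^ q < 2 ^ N"
    using assms by (simp add: exp_of_nat_mult)
  moreover have "real N \<le> (2 * real q + 2) * ln (real n)"
    using N ln1 by (simp add: algebra_simps)
  ultimately show thesis using that by blast
qed

section \<open>Weighted embeddings of tight trees\<close>

text \<open>
  Construction of a tight tree by adding leaves. The list collects the separators, that is, the
  \<open>(r - 1)\<close>-sets along which the edges are attached; a set occurs once for every edge attached to it.
\<close>

inductive tree_sequence :: "nat \<Rightarrow> 'v set \<Rightarrow> 'v set set \<Rightarrow> 'v set list \<Rightarrow> bool" for r where
  root: "finite h \<Longrightarrow> card h = r \<Longrightarrow> tree_sequence r h {h} []"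
| leaf: "tree_sequence r V E Ss \<Longrightarrow> g \<in> E \<Longrightarrow> \<sigma> \<subseteq> g \<Longrightarrow> Suc (card \<sigma>) = r \<Longrightarrow> v \<notin> V
    \<Longrightarrow> tree_sequence r (insert v V) (insert (insert v \<sigma>) E) (\<sigma> # Ss)"

lemma tree_sequence_facts:
  assumes "tree_sequence r V E Ss"
  shows "finite V" "finite E" "\<And>h. h \<in> E \<Longrightarrow> h \<subseteq> V" "\<And>h. h \<in> E \<Longrightarrow> card h = r"
    "\<And>\<sigma>. \<sigma> \<in> set Ss \<Longrightarrow> \<sigma> \<subseteq> V"
proof -
  have "finite V \<and> finite E \<and> (\<forall>h\<in>E. h \<subseteq> V \<and> card h = r) \<and> (\<forall>\<sigma>\<in>set Ss. \<sigma> \<subseteq> V)"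
    using assms
  proof induction
    case (leaf V E Ss g \<sigma> v)
    then have "finite \<sigma>" "v \<notin> \<sigma>" "\<sigma> \<subseteq> V" by (auto intro: finite_subset)
    with leaf show ?case by (auto simp: card_insert_disjoint)
  qed auto
  then show "finite V" "finite E" "\<And>h. h \<in> E \<Longrightarrow> h \<subseteq> V" "\<And>h. h \<in> E \<Longrightarrow> card h = r"
    "\<And>\<sigma>. \<sigma> \<in> set Ss \<Longrightarrow> \<sigma> \<subseteq> V" by auto
qed

text \<open>
  The ordering of the edges of a tight tree is read off from left to right, by induction on the
  length of its prefixes.
\<close>

lemma tight_tree_sequence:
  assumes "tight_tree r T" "hedges T \<noteq> {}" "r > 0"
  obtains Ss where "tree_sequence r (hverts T) (hedges T) Ss"
proof -
  have T: "r_graph r T" "hverts T = \<Union> (hedges T)"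
    using assms(1) by (simp_all add: tight_tree_def)
  have rg: "finite (hverts T)" "\<And>e. e \<in> hedges T \<Longrightarrow> e \<subseteq> hverts T \<and> card e = r"
    using T(1) by (simp_all add: r_graph_def)
  obtain hs where H: "distinct hs \<and> set hs = hedges T \<and>
        (\<forall>i. 1 \<le> i \<and> i < length hs \<longrightarrow>
          (\<exists>v\<in>hs ! i. \<exists>s<i. v \<notin> (\<Union>j<i. hs ! j) \<and> hs ! i - {v} \<subseteq> hs ! s))"
    using assms(1) unfolding tight_tree_def by (elim exE conjE, intro that conjI)
  then have hs: "set hs = hedges T" and
    step: "\<And>i. 1 \<le> i \<Longrightarrow> i < length hs \<Longrightarrow>
          \<exists>v\<in>hs ! i. \<exists>s<i. v \<notin> (\<Union>j<i. hs ! j) \<and> hs ! i - {v} \<subseteq> hs ! s"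
    by simp_all
  have len: "length hs \<ge> 1" using hs assms(2) by (cases hs) auto
  have edge: "finite (hs ! i)" "card (hs ! i) = r" if "i < length hs" for i
  proof -
    have "hs ! i \<in> hedges T" using nth_mem[OF that] hs by simp
    then show "finite (hs ! i)" "card (hs ! i) = r"
      using rg(1) rg(2)[of "hs ! i"] finite_subset by blast+
  qed
  have "\<exists>Ss. tree_sequence r (\<Union> (set (take k hs))) (set (take k hs)) Ss"
    if "1 \<le> k" "k \<le> length hs" for k
    using that
  proof (induction k rule: nat_induct_at_least)
    case base
    have "set (take 1 hs) = {hs ! 0}" using len by (cases hs) auto
    moreover have "tree_sequence r (hs ! 0) {hs ! 0} []"
      using len by (intro tree_sequence.root edge) auto
    ultimately show ?case by (intro exI[of _ "[]"]) simp
  next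
    case (Suc k)
    then obtain Ss where Ss: "tree_sequence r (\<Union> (set (take k hs))) (set (take k hs)) Ss" by auto
    have k: "1 \<le> k" "k < length hs" using Suc by auto
    obtain v s where v: "v \<in> hs ! k" "s < k" "v \<notin> (\<Union>j<k. hs ! j)" "hs ! k - {v} \<subseteq> hs ! s"
      using step[OF k] by blast
    have set_take: "set (take k hs) = (!) hs ` {..<k}"
      using k nth_image[of k hs] by (simp add: atLeast0LessThan)
    have "hs ! s \<in> set (take k hs)" "v \<notin> \<Union> (set (take k hs))"
      using v by (auto simp: set_take)
    moreover have "Suc (card (hs ! k - {v})) = r"
      using edge[OF k(2)] v(1) assms(3) by (metis card.remove)
    ultimately have "tree_sequence r (insert v (\<Union> (set (take k hs))))
       (insert (insert v (hs ! k - {v})) (set (take k hs))) ((hs ! k - {v}) # Ss)"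
      using Ss v(4) by (intro tree_sequence.leaf[where g = "hs ! s"]) auto
    moreover have "insert v (hs ! k - {v}) = hs ! k" using v(1) by blast
    moreover have "set (take (Suc k) hs) = insert (hs ! k) (set (take k hs))"
      using k by (simp add: take_Suc_conv_app_nth)
    moreover have "insert v (\<Union> (set (take k hs))) = \<Union> (insert (hs ! k) (set (take k hs)))"
    proof -
      have "hs ! k - {v} \<subseteq> \<Union> (set (take k hs))" using v by (auto simp: set_take)
      then show ?thesis using v(1) by auto
    qed
    ultimately show ?case by metis
  qed
  from this[of "length hs"] len show thesis using hs T(2) that by auto
qed

definition codegree_nbrs :: "'b set set \<Rightarrow> 'b set \<Rightarrow> 'b set" where
  "codegree_nbrs \<E> \<tau> = {x. x \<notin> \<tau> \<and> insert x \<tau> \<in> \<E>}"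

text \<open>
  Up to normalisation, this is the probability of \<open>\<phi>\<close> if the first tree edge is placed uniformly at
  random and each further vertex is a uniformly random extension of the image of its separator. It
  depends on the separators but not on the order in which they are listed.
\<close>

definition walk_weight :: "'b set set \<Rightarrow> 'v set set \<Rightarrow> 'v set list \<Rightarrow> ('v \<Rightarrow> 'b) \<Rightarrow> real" where
  "walk_weight \<E> E Ss \<phi> =
     (if \<forall>h\<in>E. \<phi> ` h \<in> \<E> then \<Prod>\<sigma>\<leftarrow>Ss. 1 / real (card (codegree_nbrs \<E> (\<phi> ` \<sigma>))) else 0)"

lemma walk_weight_nonneg: "0 \<le> walk_weight \<E> E Ss \<phi>"
proof -
  have "0 \<le> (\<Prod>\<sigma>\<leftarrow>Ss. 1 / real (card (codegree_nbrs \<E> (\<phi> ` \<sigma>))))" by (induction Ss) auto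
  then show ?thesis by (simp add: walk_weight_def)
qed

text \<open>
  Attaching a leaf multiplies the weight by the transition probability of its new vertex.
\<close>

lemma walk_weight_leaf:
  assumes "v \<notin> V" "\<And>h. h \<in> E \<Longrightarrow> h \<subseteq> V" "\<And>\<rho>. \<rho> \<in> set Ss \<Longrightarrow> \<rho> \<subseteq> V" "\<sigma> \<subseteq> V"
  shows "walk_weight \<E> (insert (insert v \<sigma>) E) (\<sigma> # Ss) (\<phi>(v := x)) =
    walk_weight \<E> E Ss \<phi> *
      (of_bool (insert x (\<phi> ` \<sigma>) \<in> \<E>) / real (card (codegree_nbrs \<E> (\<phi> ` \<sigma>))))"
proof -
  have img: "(\<phi>(v := x)) ` \<rho> = \<phi> ` \<rho>" if "\<rho> \<subseteq> V" for \<rho>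
    using that assms(1) by (intro image_cong) auto
  have E: "(\<forall>h\<in>E. (\<phi>(v := x)) ` h \<in> \<E>) = (\<forall>h\<in>E. \<phi> ` h \<in> \<E>)"
    using assms(2) img by simp
  have S: "map (\<lambda>\<sigma>. 1 / real (card (codegree_nbrs \<E> ((\<phi>(v := x)) ` \<sigma>)))) Ss
     = map (\<lambda>\<sigma>. 1 / real (card (codegree_nbrs \<E> (\<phi> ` \<sigma>)))) Ss"
    using assms(3) img by (intro map_cong) auto
  have leaf: "(\<phi>(v := x)) ` insert v \<sigma> = insert x (\<phi> ` \<sigma>)"
    unfolding image_insert img[OF assms(4)] by simp
  have hom: "(\<forall>h\<in>insert (insert v \<sigma>) E. (\<phi>(v := x)) ` h \<in> \<E>)
      = (insert x (\<phi> ` \<sigma>) \<in> \<E> \<and> (\<forall>h\<in>E. \<phi> ` h \<in> \<E>))"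
    by (simp only: ball_simps E leaf)
  show ?thesis
    unfolding walk_weight_def hom list.map prod_list.Cons S img[OF assms(4)] by simp
qed

lemma sum_PiE_insert:
  fixes f :: "('v \<Rightarrow> 'b) \<Rightarrow> real"
  assumes "finite V" "v \<notin> V" "\<And>u. finite (B u)"
  shows "(\<Sum>\<phi>\<in>PiE (insert v V) B. f \<phi>) = (\<Sum>\<phi>\<in>PiE V B. \<Sum>x\<in>B v. f (\<phi>(v := x)))"
proof -
  have "(\<Sum>\<phi>\<in>PiE (insert v V) B. f \<phi>) = (\<Sum>(x, \<phi>)\<in>B v \<times> PiE V B. f (\<phi>(v := x)))"
    unfolding PiE_insert_eq
    by (subst sum.reindex[OF inj_combinator[OF assms(2)]]) (simp add: case_prod_unfold)
  also have "\<dots> = (\<Sum>x\<in>B v. \<Sum>\<phi>\<in>PiE V B. f (\<phi>(v := x)))"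
    by (simp add: sum.cartesian_product)
  finally show ?thesis by (simp add: sum.swap[of _ "B v"])
qed

lemma sum_walk_weight_leaf:
  assumes "tree_sequence r V E Ss" "v \<notin> V" "\<sigma> \<subseteq> V" "\<And>u. finite (B u)"
  shows "(\<Sum>\<phi>\<in>PiE (insert v V) B. c \<phi> * walk_weight \<E> (insert (insert v \<sigma>) E) (\<sigma> # Ss) \<phi>)
    = (\<Sum>\<phi>\<in>PiE V B. \<Sum>x\<in>B v. c (\<phi>(v := x)) * (walk_weight \<E> E Ss \<phi> *
      (of_bool (insert x (\<phi> ` \<sigma>) \<in> \<E>) / real (card (codegree_nbrs \<E> (\<phi> ` \<sigma>))))))"
proof -
  note facts = tree_sequence_facts[OF assms(1)]
  have "walk_weight \<E> (insert (insert v \<sigma>) E) (\<sigma> # Ss) (\<phi>(v := x)) =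
    walk_weight \<E> E Ss \<phi> *
      (of_bool (insert x (\<phi> ` \<sigma>) \<in> \<E>) / real (card (codegree_nbrs \<E> (\<phi> ` \<sigma>))))" for \<phi> x
    by (rule walk_weight_leaf[OF assms(2) _ _ assms(3)]) (use facts in auto)
  then show ?thesis
    unfolding sum_PiE_insert[OF facts(1) assms(2,4)] by simp
qed

text \<open>
  An \<open>r\<close>-graph \<open>\<E>\<close> on \<open>Y\<close> in which every \<open>(r - 1)\<close>-set has codegree zero or at least \<open>A\<close>.
\<close>

locale codegree_host =
  fixes Y :: "'b set" and \<E> :: "'b set set" and r :: nat and A :: real
  assumes finite_Y: "finite Y"
    and edge_sub: "\<And>e. e \<in> \<E> \<Longrightarrow> e \<subseteq> Y"
    and edge_card: "\<And>e. e \<in> \<E> \<Longrightarrow> card e = r"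
    and A_ge_1: "1 \<le> A"
    and codegree: "\<And>\<tau>. Suc (card \<tau>) = r \<Longrightarrow> codegree_nbrs \<E> \<tau> \<noteq> {} \<Longrightarrow>
      A \<le> real (card (codegree_nbrs \<E> \<tau>))"
begin

lemma finite_nbrs: "finite (codegree_nbrs \<E> \<tau>)"
  by (rule finite_subset[OF _ finite_Y]) (use edge_sub in \<open>auto simp: codegree_nbrs_def\<close>)

text \<open>
  An edge has exactly \<open>r\<close> vertices, so a map that sends a tree edge onto an edge is injective there;
  the new vertex of a leaf is therefore a genuine neighbour of the image of the separator.
\<close>

lemma in_nbrs:
  assumes "insert x (\<phi> ` \<sigma>) \<in> \<E>" "finite \<sigma>" "Suc (card \<sigma>) = r"
  shows "x \<in> codegree_nbrs \<E> (\<phi> ` \<sigma>)" "Suc (card (\<phi> ` \<sigma>)) = r"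
proof -
  have "card (insert x (\<phi> ` \<sigma>)) = Suc (card \<sigma>)" using edge_card assms by simp
  moreover have "card (\<phi> ` \<sigma>) \<le> card \<sigma>" using assms(2) by (rule card_image_le)
  moreover have "card (insert x (\<phi> ` \<sigma>)) = (if x \<in> \<phi> ` \<sigma> then card (\<phi> ` \<sigma>) else Suc (card (\<phi> ` \<sigma>)))"
    using assms(2) by (simp add: card_insert_if)
  ultimately have "x \<notin> \<phi> ` \<sigma>" "card (\<phi> ` \<sigma>) = card \<sigma>" by (auto split: if_splits)
  then show "x \<in> codegree_nbrs \<E> (\<phi> ` \<sigma>)" "Suc (card (\<phi> ` \<sigma>)) = r"
    using assms by (auto simp: codegree_nbrs_def)
qed

lemma transition_le:
  assumes "finite \<sigma>" "Suc (card \<sigma>) = r"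
  shows "of_bool (insert x (\<phi> ` \<sigma>) \<in> \<E>) / real (card (codegree_nbrs \<E> (\<phi> ` \<sigma>))) \<le> 1 / A"
proof (cases "insert x (\<phi> ` \<sigma>) \<in> \<E>")
  case True
  from in_nbrs[OF this assms] have "A \<le> real (card (codegree_nbrs \<E> (\<phi> ` \<sigma>)))"
    by (intro codegree) auto
  with A_ge_1 show ?thesis by (simp add: frac_le)
qed (use A_ge_1 in simp)

lemma transition_sum_le:
  assumes "finite \<sigma>" "Suc (card \<sigma>) = r" "finite X"
  shows "(\<Sum>x\<in>X. of_bool (insert x (\<phi> ` \<sigma>) \<in> \<E>) / real (card (codegree_nbrs \<E> (\<phi> ` \<sigma>)))) \<le> 1"
proof -
  let ?N = "codegree_nbrs \<E> (\<phi> ` \<sigma>)"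
  have "(\<Sum>x\<in>X. of_bool (insert x (\<phi> ` \<sigma>) \<in> \<E>) :: real) \<le> real (card ?N)"
  proof -
    have "(\<Sum>x\<in>X. of_bool (insert x (\<phi> ` \<sigma>) \<in> \<E>) :: real)
       = real (card {x \<in> X. insert x (\<phi> ` \<sigma>) \<in> \<E>})"
      using assms(3) by (simp add: of_bool_def sum.If_cases Int_def)
    also have "\<dots> \<le> real (card ?N)"
      using in_nbrs(1)[OF _ assms(1,2)] by (intro of_nat_mono card_mono finite_nbrs) auto
    finally show ?thesis .
  qed
  then show ?thesis
    by (simp add: sum_divide_distrib[symmetric] divide_le_eq)
qed

text \<open>
  Prescribing the images of the vertices in \<open>U\<close>, expressed by \<open>B u\<close> having at most one element, costs a
  factor \<open>A\<close> for each vertex beyond the \<open>r\<close> vertices of one edge inside \<open>U\<close>. The induction removes the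
  last leaf. When \<open>U\<close> contains an edge of the remaining tree, the leaf is summed out: a free leaf
  contributes a factor at most 1 and a prescribed one at most \<open>1 / A\<close>. When the leaf edge is the only
  tree edge inside \<open>U\<close>, the root is moved to its parent \<open>g\<close>: the vertex \<open>u\<close> of \<open>g\<close> that is not in \<open>U\<close>
  takes each of its \<open>d\<close> possible values, where \<open>d\<close> is the codegree of the separator, and the factor
  \<open>1 / d\<close> of the leaf cancels this number. Thus \<open>u\<close> replaces \<open>v\<close>, and the number of prescribed
  vertices does not change.
\<close>

lemma rooted_walk_weight_le:
  assumes "tree_sequence r V E Ss"
    and "\<And>u. B u \<subseteq> Y" "\<And>u. u \<in> U \<Longrightarrow> card (B u) \<le> 1"
    and "h \<in> E" "h \<subseteq> U" "U \<subseteq> V"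
  shows "(\<Sum>\<phi>\<in>PiE V B. walk_weight \<E> E Ss \<phi>) \<le> (1 / A) ^ (card U - r)"
  using assms
proof (induction arbitrary: B U h)
  case (root g)
  have "(\<Sum>\<phi>\<in>PiE g B. walk_weight \<E> {g} [] \<phi>) \<le> (\<Sum>\<phi>\<in>PiE g B. 1)"
    by (intro sum_mono) (simp add: walk_weight_def)
  also have "\<dots> = (\<Prod>u\<in>g. real (card (B u)))"
    using root by (simp add: card_PiE)
  also have "\<dots> \<le> 1" using root by (intro prod_le_1) auto
  finally show ?case using root by simp
next
  case (leaf V E Ss g \<sigma> v)
  note facts = tree_sequence_facts[OF leaf.hyps(1)]
  have fin: "finite (B u)" for u using leaf finite_Y by (meson finite_subset)
  have "\<sigma> \<subseteq> V" using leaf.hyps(3) facts(3)[OF leaf.hyps(2)] by blast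
  then have \<sigma>: "\<sigma> \<subseteq> V" "finite \<sigma>" using finite_subset[OF _ facts(1)] by auto
  have U: "finite U" using leaf.prems(5) facts(1) by (meson finite_insert finite_subset)
  let ?w = "walk_weight \<E> E Ss"
  let ?c = "\<lambda>\<phi>. real (card (codegree_nbrs \<E> (\<phi> ` \<sigma>)))"
  let ?p = "\<lambda>\<phi> x. of_bool (insert x (\<phi> ` \<sigma>) \<in> \<E>) / ?c \<phi>"
  have expand: "(\<Sum>\<phi>\<in>PiE (insert v V) B. walk_weight \<E> (insert (insert v \<sigma>) E) (\<sigma> # Ss) \<phi>)
     = (\<Sum>\<phi>\<in>PiE V B. ?w \<phi> * (\<Sum>x\<in>B v. ?p \<phi> x))"
    using sum_walk_weight_leaf[OF leaf.hyps(1,5) \<sigma>(1) fin, of "\<lambda>_. 1" \<E>]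
    by (simp only: mult_1 sum_distrib_left)
  show ?case
  proof (cases "\<exists>h'\<in>E. h' \<subseteq> U")
    case True
    then obtain h' where h': "h' \<in> E" "h' \<subseteq> U - {v}" using facts leaf.hyps by blast
    have IH: "(\<Sum>\<phi>\<in>PiE V B. ?w \<phi>) \<le> (1 / A) ^ (card (U - {v}) - r)"
      using leaf.prems h' by (intro leaf.IH) auto
    define q where "q = (if v \<in> U then 1 / A else 1)"
    have q: "(\<Sum>x\<in>B v. ?p \<phi> x) \<le> q" for \<phi>
    proof (cases "v \<in> U")
      case True
      have "(\<Sum>x\<in>B v. ?p \<phi> x) \<le> real (card (B v)) * (1 / A)"
        by (rule sum_bounded_above) (rule transition_le[OF \<sigma>(2) leaf.hyps(4)])
      also have "\<dots> \<le> 1 * (1 / A)" using leaf.prems(2)[OF True] A_ge_1 by (intro mult_right_mono) auto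
      finally show ?thesis using True by (simp add: q_def)
    next
      case False
      then show ?thesis using transition_sum_le[OF \<sigma>(2) leaf.hyps(4) fin] by (simp add: q_def)
    qed
    have "(\<Sum>\<phi>\<in>PiE V B. ?w \<phi> * (\<Sum>x\<in>B v. ?p \<phi> x)) \<le> (\<Sum>\<phi>\<in>PiE V B. ?w \<phi> * q)"
      by (intro sum_mono mult_left_mono q walk_weight_nonneg)
    also have "\<dots> = (\<Sum>\<phi>\<in>PiE V B. ?w \<phi>) * q" by (simp add: sum_distrib_right)
    also have "\<dots> \<le> (1 / A) ^ (card (U - {v}) - r) * q"
      using IH A_ge_1 by (intro mult_right_mono) (auto simp: q_def)
    also have "\<dots> = (1 / A) ^ (card U - r)"
    proof (cases "v \<in> U")
      case True
      have "r \<le> card (U - {v})" using card_mono[of "U - {v}" h'] h' facts(4) U by auto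
      then have "card U - r = Suc (card (U - {v}) - r)" 
        using card_Suc_Diff1[OF U True] by linarith
      then show ?thesis using True by (simp add: q_def)
    qed (simp add: q_def)
    finally show ?thesis unfolding expand .
  next
    case False
    then have h: "insert v \<sigma> \<subseteq> U" using leaf.prems(3,4) by auto
    show ?thesis
    proof (cases "PiE V B = {}")
      case True
      then show ?thesis unfolding expand using A_ge_1 by simp
    next
      case False
      then obtain \<phi>0 where \<phi>0: "\<phi>0 \<in> PiE V B" by blast
      define \<tau> where "\<tau> = \<phi>0 ` \<sigma>"
      \<comment> \<open>The separator lies in \<open>U\<close>, so its image is the same set \<open>\<tau>\<close> for all maps in the sum.\<close>
      have const: "\<phi> ` \<sigma> = \<tau>" if "\<phi> \<in> PiE V B" for \<phi>
        unfolding \<tau>_def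
      proof (rule image_cong)
        fix y assume y: "y \<in> \<sigma>"
        then have "\<phi> y \<in> B y" "\<phi>0 y \<in> B y" using that \<phi>0 \<sigma> by auto
        moreover have "card (B y) \<le> 1" using leaf.prems(2) h y by auto
        ultimately show "\<phi> y = \<phi>0 y" using fin card_le_Suc0_iff_eq[of "B y"] by auto
      qed simp
      let ?N = "codegree_nbrs \<E> \<tau>"
      have "card (g - \<sigma>) = 1"
        using card_Diff_subset[OF \<sigma>(2) leaf.hyps(3)] facts(4)[OF leaf.hyps(2)] leaf.hyps(4) by simp
      then obtain u where u: "g - \<sigma> = {u}" by (auto simp: card_1_singleton_iff)
      then have g: "g = insert u \<sigma>" "u \<notin> \<sigma>" using leaf.hyps(3) by auto
      have uU: "u \<notin> U" using \<open>\<not> (\<exists>h'\<in>E. h' \<subseteq> U)\<close> leaf.hyps(2) g h by auto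
      have uV: "u \<in> V" using g facts(3) leaf.hyps(2) by auto
      have "v \<in> U" using h by simp
      have cardU: "card (insert u (U - {v})) = card U"
        using card_insert_disjoint[of "U - {v}" u] card_Suc_Diff1[OF U \<open>v \<in> U\<close>] U uU by auto
      have IH: "(\<Sum>\<phi>\<in>PiE V (B(u := {y})). ?w \<phi>) \<le> (1 / A) ^ (card U - r)"
        if "y \<in> ?N" for y
      proof -
        have "y \<in> Y" using that edge_sub by (auto simp: codegree_nbrs_def)
        then have "(\<Sum>\<phi>\<in>PiE V (B(u := {y})). ?w \<phi>)
            \<le> (1 / A) ^ (card (insert u (U - {v})) - r)"
          using leaf.prems g h uV leaf.hyps \<sigma>(1) by (intro leaf.IH[where h = g]) auto
        then show ?thesis by (simp only: cardU)
      qed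
      have wN: "\<phi> u \<in> ?N" if "\<phi> \<in> PiE V B" "?w \<phi> \<noteq> 0" for \<phi>
      proof -
        have "\<phi> ` g \<in> \<E>" using that(2) leaf.hyps(2) by (auto simp: walk_weight_def split: if_splits)
        then have "insert (\<phi> u) (\<phi> ` \<sigma>) \<in> \<E>" by (simp add: g)
        from in_nbrs(1)[OF this \<sigma>(2) leaf.hyps(4)] show ?thesis using const[OF that(1)] by simp
      qed
      have finP: "finite (PiE V B)" using facts(1) fin by (intro finite_PiE) auto
      have "(\<Sum>\<phi>\<in>PiE V B. ?w \<phi>) = (\<Sum>\<phi>\<in>{\<phi>\<in>PiE V B. \<phi> u \<in> ?N}. ?w \<phi>)"
        \<comment> \<open>Maps with \<open>\<phi> u\<close> outside the neighbourhood of \<open>\<tau>\<close> do not map \<open>g\<close> to an edge.\<close>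
        using wN finP by (intro sum.mono_neutral_right) auto
      also have "\<dots> = (\<Sum>y\<in>?N. \<Sum>\<phi>\<in>{\<phi>\<in>{\<phi>\<in>PiE V B. \<phi> u \<in> ?N}. \<phi> u = y}. ?w \<phi>)"
        using finP finite_nbrs by (intro sum.group[symmetric]) auto
      also have "\<dots> \<le> (\<Sum>y\<in>?N. \<Sum>\<phi>\<in>PiE V (B(u := {y})). ?w \<phi>)"
      proof (rule sum_mono, rule sum_mono2)
        fix y assume "y \<in> ?N"
        show "finite (PiE V (B(u := {y})))" using facts(1) fin by (intro finite_PiE) auto
        show "{\<phi> \<in> {\<phi> \<in> PiE V B. \<phi> u \<in> ?N}. \<phi> u = y} \<subseteq> PiE V (B(u := {y}))"
          by (auto simp: PiE_iff extensional_def)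
      qed (rule walk_weight_nonneg)
      also have "\<dots> \<le> real (card ?N) * (1 / A) ^ (card U - r)"
        by (rule sum_bounded_above) (rule IH)
      finally have total: "(\<Sum>\<phi>\<in>PiE V B. ?w \<phi>) \<le> real (card ?N) * (1 / A) ^ (card U - r)" .
      have "(\<Sum>\<phi>\<in>PiE V B. ?w \<phi> * (\<Sum>x\<in>B v. ?p \<phi> x)) \<le> (\<Sum>\<phi>\<in>PiE V B. ?w \<phi> * (1 / real (card ?N)))"
      proof (intro sum_mono mult_left_mono walk_weight_nonneg)
        fix \<phi> assume \<phi>: "\<phi> \<in> PiE V B"
        have "(\<Sum>x\<in>B v. ?p \<phi> x) \<le> real (card (B v)) * (1 / real (card ?N))"
          by (rule sum_bounded_above) (simp add: const[OF \<phi>] divide_right_mono)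
        also have "\<dots> \<le> 1 * (1 / real (card ?N))"
          using leaf.prems(2)[OF \<open>v \<in> U\<close>] by (intro mult_right_mono) auto
        finally show "(\<Sum>x\<in>B v. ?p \<phi> x) \<le> 1 / real (card ?N)" by simp
      qed
      also have "\<dots> = (\<Sum>\<phi>\<in>PiE V B. ?w \<phi>) / real (card ?N)" by (simp add: sum_divide_distrib)
      also have "\<dots> \<le> (1 / A) ^ (card U - r)"
      proof (cases "card ?N = 0")
        case False
        then show ?thesis using total by (simp add: divide_le_eq mult.commute)
      qed (use A_ge_1 in simp)
      finally show ?thesis unfolding expand .
    qed
  qed
qed

text \<open>
  At each step at most \<open>card V\<close> of the at least \<open>2 * card V\<close> choices for the next vertex are already
  taken, so half of the transition probability leads to new vertices. The first edge can be placed
  on each edge of the host.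
\<close>

lemma injective_walk_weight_ge:
  assumes "tree_sequence r V E Ss" "2 * real (card V) \<le> A"
  shows "real (card \<E>) / 2 ^ length Ss
     \<le> (\<Sum>\<phi>\<in>PiE V (\<lambda>_. Y). of_bool (inj_on \<phi> V) * walk_weight \<E> E Ss \<phi>)"
  using assms
proof induction
  case (root h)
  let ?I = "{\<phi> \<in> PiE h (\<lambda>_. Y). inj_on \<phi> h \<and> \<phi> ` h \<in> \<E>}"
  have finP: "finite (PiE h (\<lambda>_. Y))" using root finite_Y by (intro finite_PiE) auto
  have "\<E> \<subseteq> (\<lambda>\<phi>. \<phi> ` h) ` ?I"
  proof
    fix e assume e: "e \<in> \<E>"
    have "finite e" using edge_sub[OF e] finite_Y by (rule finite_subset)
    then obtain \<phi> where \<phi>: "bij_betw \<phi> h e"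
      using root edge_card[OF e] by (metis finite_same_card_bij)
    have "bij_betw (restrict \<phi> h) h e" using \<phi> by (simp cong: bij_betw_cong)
    then have "restrict \<phi> h \<in> ?I" "restrict \<phi> h ` h = e"
      using e edge_sub[OF e] by (auto simp: bij_betw_def)
    then show "e \<in> (\<lambda>\<phi>. \<phi> ` h) ` ?I" by blast
  qed
  then have "card \<E> \<le> card ?I" using finP by (intro surj_card_le) auto
  moreover have "(\<Sum>\<phi>\<in>PiE h (\<lambda>_. Y). of_bool (inj_on \<phi> h) * walk_weight \<E> {h} [] \<phi>)
     = (\<Sum>\<phi>\<in>?I. 1)"
    using finP by (intro sum.mono_neutral_cong_right) (auto simp: walk_weight_def)
  ultimately show ?case by simp
next
  case (leaf V E Ss g \<sigma> v)
  note facts = tree_sequence_facts[OF leaf.hyps(1)]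
  have "\<sigma> \<subseteq> V" using leaf.hyps(3) facts(3)[OF leaf.hyps(2)] by blast
  then have \<sigma>: "\<sigma> \<subseteq> V" "finite \<sigma>" using finite_subset[OF _ facts(1)] by auto
  let ?w = "walk_weight \<E> E Ss"
  let ?N = "\<lambda>\<phi>. codegree_nbrs \<E> (\<phi> ` \<sigma>)"
  let ?p = "\<lambda>\<phi> x. of_bool (insert x (\<phi> ` \<sigma>) \<in> \<E>) / real (card (?N \<phi>))"
  have "card V \<le> card (insert v V)" using facts(1) leaf.hyps by simp
  then have A: "2 * real (card V) \<le> A" using leaf.prems by linarith
  have step: "of_bool (inj_on \<phi> V) * ?w \<phi> / 2
      \<le> (\<Sum>x\<in>Y. of_bool (inj_on (\<phi>(v := x)) (insert v V)) * (?w \<phi> * ?p \<phi> x))" for \<phi>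
  proof (cases "inj_on \<phi> V \<and> ?w \<phi> \<noteq> 0")
    case True
    then have "\<phi> ` g \<in> \<E>" using leaf.hyps(2) by (auto simp: walk_weight_def split: if_splits)
    have card\<sigma>: "card (\<phi> ` \<sigma>) = card \<sigma>"
      using True \<sigma>(1) by (meson card_image inj_on_subset)
    have "?N \<phi> \<noteq> {}"
    proof -
      have "card (g - \<sigma>) = 1"
        using card_Diff_subset[OF \<sigma>(2) leaf.hyps(3)] facts(4)[OF leaf.hyps(2)] leaf.hyps(4) by simp
      then obtain u where "g - \<sigma> = {u}" by (auto simp: card_1_singleton_iff)
      then have "g = insert u \<sigma>" using leaf.hyps(3) by auto
      then have "insert (\<phi> u) (\<phi> ` \<sigma>) \<in> \<E>" using \<open>\<phi> ` g \<in> \<E>\<close> by simp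
      from in_nbrs(1)[OF this \<sigma>(2) leaf.hyps(4)] show ?thesis by blast
    qed
    then have dA: "A \<le> real (card (?N \<phi>))" using codegree card\<sigma> leaf.hyps(4) by simp
    have fresh: "real (card (?N \<phi>)) / 2 \<le> real (card (?N \<phi> - \<phi> ` V))"
    proof -
      have "card (?N \<phi>) - card (\<phi> ` V) \<le> card (?N \<phi> - \<phi> ` V)"
        using facts(1) by (intro diff_card_le_card_Diff) auto
      moreover have "card (\<phi> ` V) \<le> card V" using facts(1) by (rule card_image_le)
      ultimately have "card (?N \<phi>) \<le> card V + card (?N \<phi> - \<phi> ` V)" by linarith
      then have "real (card (?N \<phi>)) \<le> real (card V) + real (card (?N \<phi> - \<phi> ` V))"
        by (metis of_nat_add of_nat_mono)
      with A dA show ?thesis by linarith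
    qed
    have "1 / 2 \<le> real (card (?N \<phi> - \<phi> ` V)) / real (card (?N \<phi>))"
      using fresh dA A_ge_1 by (simp add: pos_le_divide_eq)
    also have "\<dots> = (\<Sum>x\<in>?N \<phi> - \<phi> ` V. 1 / real (card (?N \<phi>)))" by simp
    also have "\<dots> = (\<Sum>x\<in>?N \<phi> - \<phi> ` V. of_bool (inj_on (\<phi>(v := x)) (insert v V)) * ?p \<phi> x)"
    proof (intro sum.cong refl)
      fix x assume x: "x \<in> ?N \<phi> - \<phi> ` V"
      have "inj_on (\<phi>(v := x)) (insert v V)"
        using True x leaf.hyps(5) by (auto simp: inj_on_def)
      moreover have "insert x (\<phi> ` \<sigma>) \<in> \<E>" using x by (simp add: codegree_nbrs_def)
      ultimately show "1 / real (card (?N \<phi>)) = of_bool (inj_on (\<phi>(v := x)) (insert v V)) * ?p \<phi> x"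
        by simp
    qed
    also have "\<dots> \<le> (\<Sum>x\<in>Y. of_bool (inj_on (\<phi>(v := x)) (insert v V)) * ?p \<phi> x)"
      using finite_Y edge_sub by (intro sum_mono2) (auto simp: codegree_nbrs_def)
    finally have "?w \<phi> * (1 / 2) \<le> ?w \<phi> * (\<Sum>x\<in>Y. of_bool (inj_on (\<phi>(v := x)) (insert v V)) * ?p \<phi> x)"
      by (rule mult_left_mono) (rule walk_weight_nonneg)
    also have "\<dots> = (\<Sum>x\<in>Y. of_bool (inj_on (\<phi>(v := x)) (insert v V)) * (?w \<phi> * ?p \<phi> x))"
      by (simp add: sum_distrib_left mult.left_commute)
    finally show ?thesis using True by simp
  next
    case False
    then have "of_bool (inj_on \<phi> V) * ?w \<phi> / 2 = 0" by auto
    moreover have "0 \<le> (\<Sum>x\<in>Y. of_bool (inj_on (\<phi>(v := x)) (insert v V)) * (?w \<phi> * ?p \<phi> x))"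
      using walk_weight_nonneg[of \<E> E Ss \<phi>] by (intro sum_nonneg mult_nonneg_nonneg) auto
    ultimately show ?thesis by linarith
  qed
  have "real (card \<E>) / 2 ^ length (\<sigma> # Ss) = (real (card \<E>) / 2 ^ length Ss) / 2" by simp
  also have "\<dots> \<le> (\<Sum>\<phi>\<in>PiE V (\<lambda>_. Y). of_bool (inj_on \<phi> V) * ?w \<phi>) / 2"
    using leaf.IH[OF A] by (rule divide_right_mono) simp
  also have "\<dots> \<le> (\<Sum>\<phi>\<in>PiE V (\<lambda>_. Y).
      \<Sum>x\<in>Y. of_bool (inj_on (\<phi>(v := x)) (insert v V)) * (?w \<phi> * ?p \<phi> x))"
    unfolding sum_divide_distrib by (intro sum_mono step)
  also have "\<dots> = (\<Sum>\<phi>\<in>PiE (insert v V) (\<lambda>_. Y). of_bool (inj_on \<phi> (insert v V)) *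
      walk_weight \<E> (insert (insert v \<sigma>) E) (\<sigma> # Ss) \<phi>)"
    by (rule sum_walk_weight_leaf[OF leaf.hyps(1,5) \<sigma>(1) finite_Y, symmetric])
  finally show ?case .
qed

end

section \<open>A spread family of copies in a host with large codegrees\<close>

context codegree_host
begin

lemma walk_weight_le_1: "walk_weight \<E> E Ss \<phi> \<le> 1"
proof -
  have "(\<Prod>\<sigma>\<leftarrow>Ss. 1 / real (card (codegree_nbrs \<E> (\<phi> ` \<sigma>)))) \<le> 1"
  proof (induction Ss)
    case (Cons \<sigma> Ss)
    have "(1 / real (card (codegree_nbrs \<E> (\<phi> ` \<sigma>)))) * (\<Prod>\<sigma>\<leftarrow>Ss. 1 / real (card (codegree_nbrs \<E> (\<phi> ` \<sigma>)))) \<le> 1 * 1"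
      using Cons
    proof (intro mult_mono)
      show "1 / real (card (codegree_nbrs \<E> (\<phi> ` \<sigma>))) \<le> 1"
        by (cases "card (codegree_nbrs \<E> (\<phi> ` \<sigma>))") auto
      show "0 \<le> (\<Prod>\<sigma>\<leftarrow>Ss. 1 / real (card (codegree_nbrs \<E> (\<phi> ` \<sigma>))))" by (induction Ss) auto
    qed auto
    then show ?case by simp
  qed simp
  then show ?thesis by (simp add: walk_weight_def)
qed

lemma walk_weight_ge:
  assumes "walk_weight \<E> E Ss \<phi> \<noteq> 0"
  shows "(1 / real (card Y)) ^ length Ss \<le> walk_weight \<E> E Ss \<phi>"
proof -
  have nz: "(\<Prod>\<sigma>\<leftarrow>Ss. 1 / real (card (codegree_nbrs \<E> (\<phi> ` \<sigma>)))) \<noteq> 0"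
    and eq: "walk_weight \<E> E Ss \<phi> = (\<Prod>\<sigma>\<leftarrow>Ss. 1 / real (card (codegree_nbrs \<E> (\<phi> ` \<sigma>))))"
    using assms by (auto simp: walk_weight_def split: if_splits)
  from nz have "(1 / real (card Y)) ^ length Ss
      \<le> (\<Prod>\<sigma>\<leftarrow>Ss. 1 / real (card (codegree_nbrs \<E> (\<phi> ` \<sigma>))))"
  proof (induction Ss)
    case (Cons \<sigma> Ss)
    let ?c = "card (codegree_nbrs \<E> (\<phi> ` \<sigma>))"
    have "?c > 0" using Cons.prems by (intro notI gr0I) simp
    moreover have "?c \<le> card Y"
      by (intro card_mono finite_Y) (use edge_sub in \<open>auto simp: codegree_nbrs_def\<close>)
    ultimately have "1 / real (card Y) \<le> 1 / real ?c" by (simp add: frac_le)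
    then have "1 / real (card Y) * (1 / real (card Y)) ^ length Ss
        \<le> 1 / real ?c * (\<Prod>\<sigma>\<leftarrow>Ss. 1 / real (card (codegree_nbrs \<E> (\<phi> ` \<sigma>))))"
      using Cons by (intro mult_mono) auto
    then show ?case by simp
  qed simp
  then show ?thesis by (simp only: eq)
qed

text \<open>
  If all edges in \<open>I\<close> belong to the copy determined by \<open>\<phi>\<close>, some set \<open>F'\<close> of \<open>card I\<close> edges of \<open>\<F>\<close> is
  mapped onto \<open>I\<close>, and \<open>\<phi>\<close> is prescribed on \<open>\<Union> F'\<close> by one of a bounded number of maps into
  \<open>\<Union> I\<close>. The factor in front of \<open>\<theta>\<close> bounds the number of these choices.
\<close>

lemma prescribed_edges_weight_le:
  assumes tree: "tree_sequence r V E Ss" and "\<F> \<subseteq> E" "r > 0"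
    and I: "finite I" "I \<noteq> {}" "card I \<le> card \<F>" "\<And>e. e \<in> I \<Longrightarrow> e \<subseteq> Y \<and> card e = r"
    and "0 \<le> \<theta>"
    and \<theta>: "\<And>F'. F' \<subseteq> \<F> \<Longrightarrow> card F' = card I \<Longrightarrow> (1 / A) ^ (card (\<Union> F') - r) \<le> \<theta>"
  shows "(\<Sum>\<phi>\<in>{\<phi> \<in> PiE V (\<lambda>_. Y). inj_on \<phi> V \<and> I \<subseteq> (`) \<phi> ` \<F>}. walk_weight \<E> E Ss \<phi>)
    \<le> 2 ^ card \<F> * real ((r * card \<F>) ^ card V) * \<theta>"
proof -
  note facts = tree_sequence_facts[OF tree]
  have fin\<F>: "finite \<F>" using assms(2) facts(2) by (rule finite_subset)
  define W where "W = \<Union> I"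
  define J where "J = {F'. F' \<subseteq> \<F> \<and> card F' = card I}"
  define P where "P = Sigma J (\<lambda>F'. PiE (\<Union> F') (\<lambda>_. W))"
  define M where "M = (\<lambda>p. PiE V (\<lambda>u. if u \<in> \<Union> (fst p) then {snd p u :: 'b} else Y))"
  have "W \<subseteq> Y" using I(4) unfolding W_def by blast
  then have W: "W \<subseteq> Y" "finite W" using finite_subset[OF _ finite_Y] by auto
  have "card W \<le> (\<Sum>e\<in>I. card e)" unfolding W_def by (rule card_Union_le_sum_card)
  also have "\<dots> = r * card I" using I by simp
  also have "\<dots> \<le> r * card \<F>" using I by simp
  finally have cardW: "card W \<le> r * card \<F>" .
  have J: "finite J" "card J \<le> 2 ^ card \<F>"
    using fin\<F> card_mono[of "Pow \<F>" J] by (auto simp: J_def card_Pow)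
  have JE: "finite (\<Union> F')" "\<Union> F' \<subseteq> V" "F' \<subseteq> \<F>" "card F' = card I" if "F' \<in> J" for F'
  proof -
    show "\<Union> F' \<subseteq> V" using that assms(2) facts(3) by (force simp: J_def)
    then show "finite (\<Union> F')" using facts(1) by (rule finite_subset)
  qed (use that in \<open>auto simp: J_def\<close>)
  have finP: "finite P" using J(1) JE(1) W(2) unfolding P_def
    by (intro finite_SigmaI finite_PiE) auto
  have "card P = (\<Sum>F'\<in>J. card W ^ card (\<Union> F'))"
    unfolding P_def using J(1) JE(1) W(2) by (simp add: card_PiE finite_PiE)
  also have "\<dots> \<le> (\<Sum>F'\<in>J. (r * card \<F>) ^ card V)"
  proof (rule sum_mono)
    fix F' assume "F' \<in> J"
    have "0 < card I" using I(1,2) by (simp add: card_gt_0_iff)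
    then have "0 < r * card \<F>" using assms(3) I(3) by simp
    then have "1 \<le> r * card \<F>" by linarith
    moreover have "card (\<Union> F') \<le> card V" using JE[OF \<open>F' \<in> J\<close>] facts(1) by (intro card_mono)
    ultimately have "(r * card \<F>) ^ card (\<Union> F') \<le> (r * card \<F>) ^ card V"
      by (intro power_increasing)
    moreover have "card W ^ card (\<Union> F') \<le> (r * card \<F>) ^ card (\<Union> F')"
      using cardW by (intro power_mono) auto
    ultimately show "card W ^ card (\<Union> F') \<le> (r * card \<F>) ^ card V" by linarith
  qed
  also have "\<dots> \<le> 2 ^ card \<F> * (r * card \<F>) ^ card V" using J(2) by simp
  finally have "real (card P) \<le> real (2 ^ card \<F> * (r * card \<F>) ^ card V)" by (rule of_nat_mono)
  then have cardP: "real (card P) \<le> 2 ^ card \<F> * real ((r * card \<F>) ^ card V)" by simp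
  have cover: "{\<phi> \<in> PiE V (\<lambda>_. Y). inj_on \<phi> V \<and> I \<subseteq> (`) \<phi> ` \<F>} \<subseteq> (\<Union>p\<in>P. M p)"
  proof
    fix \<phi> assume "\<phi> \<in> {\<phi> \<in> PiE V (\<lambda>_. Y). inj_on \<phi> V \<and> I \<subseteq> (`) \<phi> ` \<F>}"
    then have \<phi>: "\<phi> \<in> PiE V (\<lambda>_. Y)" "inj_on \<phi> V" "I \<subseteq> (`) \<phi> ` \<F>" by auto
    define F' where "F' = {h \<in> \<F>. \<phi> ` h \<in> I}"
    have img: "(`) \<phi> ` F' = I" using \<phi>(3) by (auto simp: F'_def)
    have "inj_on ((`) \<phi>) F'"
    proof (rule inj_on_image, rule inj_on_subset[OF \<phi>(2)])
      show "\<Union> F' \<subseteq> V" using assms(2) facts(3) by (force simp: F'_def)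
    qed
    from card_image[OF this] have F'J: "F' \<in> J" unfolding img by (simp add: J_def F'_def)
    have "restrict \<phi> (\<Union> F') \<in> PiE (\<Union> F') (\<lambda>_. W)"
      unfolding W_def img[symmetric] by auto
    moreover have "\<phi> \<in> M (F', restrict \<phi> (\<Union> F'))"
      using \<phi>(1) by (auto simp: M_def PiE_iff)
    ultimately show "\<phi> \<in> (\<Union>p\<in>P. M p)"
      using F'J unfolding P_def by (intro UN_I[of "(F', restrict \<phi> (\<Union> F'))"]) auto
  qed
  have finM: "finite (M p)" for p
    unfolding M_def using facts(1) finite_Y by (intro finite_PiE) auto
  have "(\<Sum>\<phi>\<in>{\<phi> \<in> PiE V (\<lambda>_. Y). inj_on \<phi> V \<and> I \<subseteq> (`) \<phi> ` \<F>}. walk_weight \<E> E Ss \<phi>)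
     \<le> (\<Sum>\<phi>\<in>(\<Union>p\<in>P. M p). walk_weight \<E> E Ss \<phi>)"
    using cover finP finM by (intro sum_mono2 walk_weight_nonneg) auto
  also have "\<dots> \<le> (\<Sum>p\<in>P. \<Sum>\<phi>\<in>M p. walk_weight \<E> E Ss \<phi>)"
    using finP finM walk_weight_nonneg by (intro sum_UN_le)
  also have "\<dots> \<le> (\<Sum>p\<in>P. \<theta>)"
  proof (rule sum_mono)
    fix p assume "p \<in> P"
    then obtain F' \<psi> where p: "p = (F', \<psi>)" "F' \<in> J" "\<psi> \<in> PiE (\<Union> F') (\<lambda>_. W)"
      by (auto simp: P_def)
    have "F' \<noteq> {}" using JE(4)[OF p(2)] I by (intro notI) (simp add: card_gt_0_iff)
    then obtain h where h: "h \<in> F'" by blast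
    have "(\<Sum>\<phi>\<in>M p. walk_weight \<E> E Ss \<phi>) \<le> (1 / A) ^ (card (\<Union> F') - r)"
      unfolding M_def
    proof (rule rooted_walk_weight_le[OF tree, where h = h])
      fix u
      show "(if u \<in> \<Union> (fst p) then {snd p u} else Y) \<subseteq> Y" using p W(1) by auto
      show "card (if u \<in> \<Union> (fst p) then {snd p u} else Y) \<le> 1" if "u \<in> \<Union> F'"
        using that p(1) by simp
    next
      show "h \<in> E" "h \<subseteq> \<Union> F'" "\<Union> F' \<subseteq> V" using h JE[OF p(2)] assms(2) by auto
    qed
    also have "\<dots> \<le> \<theta>" using JE[OF p(2)] by (intro \<theta>)
    finally show "(\<Sum>\<phi>\<in>M p. walk_weight \<E> E Ss \<phi>) \<le> \<theta>" .
  qed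
  also have "\<dots> = real (card P) * \<theta>" by simp
  also have "\<dots> \<le> 2 ^ card \<F> * real ((r * card \<F>) ^ card V) * \<theta>"
    using cardP assms(8) by (rule mult_right_mono)
  finally show ?thesis .
qed

text \<open>
  The weight of a copy is the sum of the weights of all maps that produce it. Working with these sums
  makes it unnecessary to count the maps behind one copy, of which there are many when \<open>V\<close> contains
  vertices outside all edges of \<open>\<F>\<close>. Each copy has weight between \<open>n ^ - length Ss\<close> and \<open>n ^ card V\<close>,
  which puts the weights into \<open>O(ln n)\<close> dyadic intervals.
\<close>

lemma spread_family_of_copies:
  fixes K :: real
  assumes tree: "tree_sequence r V E Ss" and "\<F> \<subseteq> E" "r > 0"
    and "2 * real (card V) \<le> A" "\<E> \<noteq> {}" "card Y \<ge> 3"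
  defines "K \<equiv> 4 * (real (card V + length Ss) + 1) * 2 ^ length Ss *
    (2 ^ card \<F> * real ((r * card \<F>) ^ card V))"
  obtains \<H> where "\<H> \<noteq> {}"
    "\<And>S. S \<in> \<H> \<Longrightarrow> \<exists>\<phi>. inj_on \<phi> V \<and> \<phi> ` V \<subseteq> Y \<and> S = (`) \<phi> ` \<F> \<and> S \<subseteq> \<E>"
    "\<And>I \<theta>. finite I \<Longrightarrow> I \<noteq> {} \<Longrightarrow> card I \<le> card \<F> \<Longrightarrow> (\<And>e. e \<in> I \<Longrightarrow> e \<subseteq> Y \<and> card e = r)
      \<Longrightarrow> 0 \<le> \<theta> \<Longrightarrow> (\<And>F'. F' \<subseteq> \<F> \<Longrightarrow> card F' = card I \<Longrightarrow> (1 / A) ^ (card (\<Union> F') - r) \<le> \<theta>)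
      \<Longrightarrow> real (card {S \<in> \<H>. I \<subseteq> S}) * real (card \<E>) \<le> K * ln (real (card Y)) * real (card \<H>) * \<theta>"
proof -
  note facts = tree_sequence_facts[OF tree]
  let ?w = "walk_weight \<E> E Ss"
  define \<Phi> where "\<Phi> = {\<phi> \<in> PiE V (\<lambda>_. Y). inj_on \<phi> V \<and> ?w \<phi> \<noteq> 0}"
  define \<kappa> where "\<kappa> = (\<lambda>\<phi> :: _ \<Rightarrow> 'b. (`) \<phi> ` \<F>)"
  define X where "X = \<kappa> ` \<Phi>"
  define w where "w = (\<lambda>S. \<Sum>\<phi>\<in>{\<phi> \<in> \<Phi>. \<kappa> \<phi> = S}. ?w \<phi>)"
  define a where "a = (1 / real (card Y)) ^ length Ss"
  have finPi: "finite (PiE V (\<lambda>_. Y))" using facts(1) finite_Y by (intro finite_PiE) auto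
  then have fin\<Phi>: "finite \<Phi>" by (simp add: \<Phi>_def)
  have total: "sum w X = (\<Sum>\<phi>\<in>\<Phi>. ?w \<phi>)"
    unfolding w_def using fin\<Phi> by (intro sum.group) (auto simp: X_def)
  also have "\<dots> = (\<Sum>\<phi>\<in>PiE V (\<lambda>_. Y). of_bool (inj_on \<phi> V) * ?w \<phi>)"
    using finPi by (intro sum.mono_neutral_cong_left) (auto simp: \<Phi>_def)
  also have "\<dots> \<ge> real (card \<E>) / 2 ^ length Ss"
    by (rule injective_walk_weight_ge[OF tree assms(4)])
  finally have big: "real (card \<E>) / 2 ^ length Ss \<le> sum w X" .
  have "finite \<E>" by (rule finite_subset[of _ "Pow Y"]) (use edge_sub finite_Y in auto)
  then have "card \<E> > 0" using assms(5) by (simp add: card_gt_0_iff)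
  then have pos: "0 < sum w X" using big by (smt (verit) divide_pos_pos of_nat_0_less_iff zero_less_power)
  have X: "finite X" "X \<noteq> {}" using fin\<Phi> pos by (auto simp: X_def)
  obtain N where N: "real (card Y) ^ (card V + length Ss) < 2 ^ N"
    "real N \<le> (2 * real (card V + length Ss) + 2) * ln (real (card Y))"
    using power_less_two_power_log[OF assms(6)] by blast
  have a: "0 < a" using assms(6) by (simp add: a_def)
  have bnd: "a \<le> w S \<and> w S < 2 ^ N * a" if S: "S \<in> X" for S
  proof
    obtain \<phi> where \<phi>: "\<phi> \<in> \<Phi>" "\<kappa> \<phi> = S" using S by (auto simp: X_def)
    have "a \<le> ?w \<phi>" unfolding a_def using \<phi> by (intro walk_weight_ge) (simp add: \<Phi>_def)
    also have "\<dots> \<le> w S"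
      unfolding w_def using \<phi> fin\<Phi> by (intro member_le_sum walk_weight_nonneg) auto
    finally show "a \<le> w S" .
    have "w S \<le> (\<Sum>\<phi>\<in>PiE V (\<lambda>_. Y). ?w \<phi>)"
      unfolding w_def by (intro sum_mono2 finPi walk_weight_nonneg) (auto simp: \<Phi>_def)
    also have "\<dots> \<le> real (card (PiE V (\<lambda>_. Y))) * 1"
      by (intro sum_bounded_above walk_weight_le_1)
    also have "\<dots> = real (card Y) ^ (card V + length Ss) * a"
      using facts(1) assms(6) by (simp add: card_PiE a_def power_add power_one_over)
    also have "\<dots> < 2 ^ N * a" using N(1) a by (rule mult_strict_right_mono)
    finally show "w S < 2 ^ N * a" .
  qed
  obtain \<H> where \<H>: "\<H> \<subseteq> X" "\<H> \<noteq> {}"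
    "\<And>Q. real (card {S \<in> \<H>. Q S}) * sum w X \<le> 2 * real N * real (card \<H>) * sum w {S \<in> X. Q S}"
    using near_uniform_subfamily[where w = w and N = N, OF X a bnd] by blast
  show thesis
  proof (rule that[OF \<H>(2)])
    fix S assume "S \<in> \<H>"
    then obtain \<phi> where \<phi>: "\<phi> \<in> \<Phi>" "S = \<kappa> \<phi>" using \<H>(1) by (auto simp: X_def)
    then have "S \<subseteq> \<E>" using assms(2) by (auto simp: \<Phi>_def \<kappa>_def walk_weight_def split: if_splits)
    with \<phi> show "\<exists>\<phi>. inj_on \<phi> V \<and> \<phi> ` V \<subseteq> Y \<and> S = (`) \<phi> ` \<F> \<and> S \<subseteq> \<E>"
      by (intro exI[of _ \<phi>]) (auto simp: \<Phi>_def \<kappa>_def)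
  next
    fix I \<theta>
    assume I: "finite I" "I \<noteq> {}" "card I \<le> card \<F>" "\<And>e. e \<in> I \<Longrightarrow> e \<subseteq> Y \<and> card e = r"
      and \<theta>: "0 \<le> \<theta>" "\<And>F'. F' \<subseteq> \<F> \<Longrightarrow> card F' = card I \<Longrightarrow> (1 / A) ^ (card (\<Union> F') - r) \<le> \<theta>"
    let ?Q = "2 ^ card \<F> * real ((r * card \<F>) ^ card V)"
    let ?d = "real (card {S \<in> \<H>. I \<subseteq> S})"
    have "sum w {S \<in> X. I \<subseteq> S} = (\<Sum>\<phi>\<in>{\<phi> \<in> \<Phi>. I \<subseteq> \<kappa> \<phi>}. ?w \<phi>)"
    proof -
      have "(\<Sum>S\<in>{S \<in> X. I \<subseteq> S}. \<Sum>\<phi>\<in>{\<phi> \<in> {\<phi> \<in> \<Phi>. I \<subseteq> \<kappa> \<phi>}. \<kappa> \<phi> = S}. ?w \<phi>) = (\<Sum>\<phi>\<in>{\<phi> \<in> \<Phi>. I \<subseteq> \<kappa> \<phi>}. ?w \<phi>)"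
        using fin\<Phi> X(1) by (intro sum.group) (auto simp: X_def)
      moreover have "{\<phi> \<in> {\<phi> \<in> \<Phi>. I \<subseteq> \<kappa> \<phi>}. \<kappa> \<phi> = S} = {\<phi> \<in> \<Phi>. \<kappa> \<phi> = S}" if "I \<subseteq> S" for S
        using that by auto
      ultimately show ?thesis unfolding w_def by simp
    qed
    also have "\<dots> \<le> (\<Sum>\<phi>\<in>{\<phi> \<in> PiE V (\<lambda>_. Y). inj_on \<phi> V \<and> I \<subseteq> (`) \<phi> ` \<F>}. ?w \<phi>)"
      using finPi by (intro sum_mono2 walk_weight_nonneg) (auto simp: \<Phi>_def \<kappa>_def)
    also have "\<dots> \<le> ?Q * \<theta>"
      by (rule prescribed_edges_weight_le[OF tree assms(2,3) I \<theta>])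
    finally have small: "sum w {S \<in> X. I \<subseteq> S} \<le> ?Q * \<theta>" .
    have "?d * real (card \<E>) = 2 ^ length Ss * (?d * (real (card \<E>) / 2 ^ length Ss))" by simp
    also have "\<dots> \<le> 2 ^ length Ss * (?d * sum w X)"
      using big by (intro mult_left_mono) auto
    also have "\<dots> \<le> 2 ^ length Ss * (2 * real N * real (card \<H>) * sum w {S \<in> X. I \<subseteq> S})"
      using \<H>(3)[of "\<lambda>S. I \<subseteq> S"] by (intro mult_left_mono) auto
    also have "\<dots> \<le> 2 ^ length Ss * (2 * real N * real (card \<H>) * (?Q * \<theta>))"
      using small by (intro mult_left_mono) auto
    also have "\<dots> = (2 ^ length Ss * (2 * real (card \<H>) * (?Q * \<theta>))) * real N" by simp
    also have "\<dots> \<le> (2 ^ length Ss * (2 * real (card \<H>) * (?Q * \<theta>))) *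
        ((2 * real (card V + length Ss) + 2) * ln (real (card Y)))"
      using N(2) \<theta>(1) by (intro mult_left_mono) auto
    also have "\<dots> = K * ln (real (card Y)) * real (card \<H>) * \<theta>"
      by (simp add: K_def algebra_simps)
    finally show "?d * real (card \<E>) \<le> K * ln (real (card Y)) * real (card \<H>) * \<theta>" .
  qed
qed

end

section \<open>Cleaning the codegrees\<close>

lemma card_superedges_le:
  assumes "finite E" "\<And>e. e \<in> E \<Longrightarrow> finite e \<and> card e = r" "Suc (card \<tau>) = r"
  shows "card {e \<in> E. \<tau> \<subseteq> e} \<le> card (codegree_nbrs E \<tau>)"
proof -
  have "finite (codegree_nbrs E \<tau>)"
    by (rule finite_subset[of _ "\<Union> E"]) (use assms in \<open>auto simp: codegree_nbrs_def\<close>)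
  moreover have "{e \<in> E. \<tau> \<subseteq> e} \<subseteq> (\<lambda>x. insert x \<tau>) ` codegree_nbrs E \<tau>"
  proof
    fix e assume "e \<in> {e \<in> E. \<tau> \<subseteq> e}"
    then have e: "e \<in> E" "\<tau> \<subseteq> e" by auto
    have "finite \<tau>" using assms(2)[OF e(1)] finite_subset[OF e(2)] by simp
    then have "card (e - \<tau>) = 1" using e assms(2)[OF e(1)] assms(3) by (simp add: card_Diff_subset)
    then obtain x where "e - \<tau> = {x}" by (auto simp: card_1_singleton_iff)
    then have "e = insert x \<tau>" "x \<notin> \<tau>" using e by auto
    with e show "e \<in> (\<lambda>x. insert x \<tau>) ` codegree_nbrs E \<tau>" by (auto simp: codegree_nbrs_def)
  qed
  ultimately show ?thesis by (rule surj_card_le)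
qed

text \<open>
  Every removed edge is assigned to the \<open>(r - 1)\<close>-set that caused its removal. All edges through that
  set disappear at the same moment, so a set is responsible for at most one round, and the edges
  assigned to it were counted by a codegree below \<open>A\<close>.
\<close>

lemma codegree_cleaning:
  fixes A :: real
  assumes "finite E" "\<And>e. e \<in> E \<Longrightarrow> finite e \<and> card e = r" "0 < A"
  shows "\<exists>E' \<pi>. E' \<subseteq> E \<and>
    (\<forall>\<tau>. Suc (card \<tau>) = r \<longrightarrow> codegree_nbrs E' \<tau> \<noteq> {} \<longrightarrow> A \<le> real (card (codegree_nbrs E' \<tau>))) \<and>
    (\<forall>e\<in>E - E'. \<pi> e \<subseteq> e \<and> Suc (card (\<pi> e)) = r) \<and>
    (\<forall>\<tau>. real (card {e \<in> E - E'. \<pi> e = \<tau>}) < A)"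
  using assms(1,2)
proof (induction E rule: finite_psubset_induct)
  case (psubset E)
  show ?case
  proof (cases "\<forall>\<tau>. Suc (card \<tau>) = r \<longrightarrow> codegree_nbrs E \<tau> \<noteq> {} \<longrightarrow> A \<le> real (card (codegree_nbrs E \<tau>))")
    case True
    then show ?thesis using assms(3) by (intro exI[of _ E]) auto
  next
    case False
    then obtain \<tau> where \<tau>: "Suc (card \<tau>) = r" "codegree_nbrs E \<tau> \<noteq> {}"
      "real (card (codegree_nbrs E \<tau>)) < A" by force
    define E1 where "E1 = {e \<in> E. \<not> \<tau> \<subseteq> e}"
    obtain x where x: "insert x \<tau> \<in> E" using \<tau>(2) unfolding codegree_nbrs_def by blast
    then have "insert x \<tau> \<notin> E1" by (simp add: E1_def subset_insertI)
    with x have sub: "E1 \<subset> E" unfolding E1_def by blast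
    have unif: "finite e \<and> card e = r" if "e \<in> E1" for e
      using that psubset.prems by (simp add: E1_def)
    obtain E' \<pi> where E': "E' \<subseteq> E1"
      "\<forall>\<tau>. Suc (card \<tau>) = r \<longrightarrow> codegree_nbrs E' \<tau> \<noteq> {} \<longrightarrow> A \<le> real (card (codegree_nbrs E' \<tau>))"
      "\<forall>e\<in>E1 - E'. \<pi> e \<subseteq> e \<and> Suc (card (\<pi> e)) = r"
      "\<forall>\<rho>. real (card {e \<in> E1 - E'. \<pi> e = \<rho>}) < A"
      by (rule exE[OF psubset.IH[OF sub]]) (rule unif, assumption, elim exE conjE, rule that)
    define \<pi>' where "\<pi>' = (\<lambda>e. if \<tau> \<subseteq> e then \<tau> else \<pi> e)"
    have fibre: "real (card {e \<in> E - E'. \<pi>' e = \<rho>}) < A" for \<rho>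
    proof (cases "\<rho> = \<tau>")
      case True
      have "{e \<in> E - E'. \<pi>' e = \<rho>} \<subseteq> {e \<in> E. \<tau> \<subseteq> e}"
        using True E'(3) by (auto simp: \<pi>'_def E1_def split: if_splits)
      then have "card {e \<in> E - E'. \<pi>' e = \<rho>} \<le> card {e \<in> E. \<tau> \<subseteq> e}"
        using psubset.hyps by (intro card_mono) auto
      also have "\<dots> \<le> card (codegree_nbrs E \<tau>)"
        using psubset.hyps psubset.prems \<tau>(1) by (rule card_superedges_le)
      finally show ?thesis using \<tau>(3) by linarith
    next
      case False
      have "{e \<in> E - E'. \<pi>' e = \<rho>} = {e \<in> E1 - E'. \<pi> e = \<rho>}"
        using False by (auto simp: \<pi>'_def E1_def split: if_splits)
      then show ?thesis using E'(4) by simp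
    qed
    have "\<forall>e\<in>E - E'. \<pi>' e \<subseteq> e \<and> Suc (card (\<pi>' e)) = r"
      using E'(3) \<tau>(1) by (auto simp: \<pi>'_def E1_def)
    moreover have "E' \<subseteq> E" using E'(1) by (auto simp: E1_def)
    ultimately show ?thesis using fibre E'(2) by blast
  qed
qed

text \<open>
  Greedy choice: for each \<open>\<sigma>\<close> at least \<open>b\<close> elements of \<open>B \<sigma>\<close> avoid \<open>X\<close> and the labels \<open>\<xi>\<close> used so far.
\<close>

lemma card_distinct_representatives_ge:
  assumes "finite P" "\<And>\<sigma>. \<sigma> \<in> P \<Longrightarrow> finite (B \<sigma>)" "\<And>\<sigma>. \<sigma> \<in> P \<Longrightarrow> inj_on \<xi> (B \<sigma>)"
    and "finite X" "\<And>\<sigma>. \<sigma> \<in> P \<Longrightarrow> b + card X + card P \<le> card (B \<sigma>)"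
  shows "b ^ card P \<le> card {c \<in> PiE P B. inj_on (\<lambda>\<sigma>. \<xi> (c \<sigma>)) P \<and> (\<forall>\<sigma>\<in>P. \<xi> (c \<sigma>) \<notin> X)}"
  using assms(1,2,3,5)
proof (induction P rule: finite_induct)
  case (insert \<sigma> P)
  define G where "G = (\<lambda>P. {c \<in> PiE P B. inj_on (\<lambda>\<sigma>. \<xi> (c \<sigma>)) P \<and> (\<forall>\<sigma>\<in>P. \<xi> (c \<sigma>) \<notin> X)})"
  define R where "R = (\<lambda>c. {e \<in> B \<sigma>. \<xi> e \<notin> X \<union> (\<lambda>\<rho>. \<xi> (c \<rho>)) ` P})"
  have finG: "finite (G Q)" if "Q \<subseteq> insert \<sigma> P" for Q
  proof -
    have "finite (PiE Q B)" using that finite_subset[OF that] insert.hyps insert.prems(1)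
      by (intro finite_PiE) auto
    then show ?thesis by (simp add: G_def)
  qed
  have finR: "finite (R c)" for c using insert.prems by (simp add: R_def)
  have R: "b \<le> card (R c)" for c
  proof -
    let ?Z = "X \<union> (\<lambda>\<rho>. \<xi> (c \<rho>)) ` P"
    have "card (\<xi> ` B \<sigma>) - card ?Z \<le> card (\<xi> ` B \<sigma> - ?Z)"
      using insert.hyps assms(4) by (intro diff_card_le_card_Diff) auto
    also have "\<xi> ` B \<sigma> - ?Z = \<xi> ` R c" by (auto simp: R_def)
    also have "card (\<xi> ` R c) \<le> card (R c)" using finR by (rule card_image_le)
    finally have "card (B \<sigma>) - card ?Z \<le> card (R c)"
      using insert.prems(2)[of \<sigma>] by (simp add: card_image)
    moreover have "card ?Z \<le> card X + card P"
      using card_Un_le[of X "(\<lambda>\<rho>. \<xi> (c \<rho>)) ` P"] card_image_le[OF insert.hyps(1), of "\<lambda>\<rho>. \<xi> (c \<rho>)"]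
      by linarith
    moreover have "b + card X + card (insert \<sigma> P) \<le> card (B \<sigma>)" using insert.prems(3) by simp
    ultimately show ?thesis using insert.hyps by simp
  qed
  have "b ^ card P \<le> card (G P)"
    unfolding G_def
  proof (rule insert.IH)
    fix \<rho> assume "\<rho> \<in> P"
    then show "b + card X + card P \<le> card (B \<rho>)"
      using insert.prems(3)[of \<rho>] insert.hyps by simp
  qed (use insert.prems in auto)
  then have "b ^ card (insert \<sigma> P) \<le> card (G P) * b" using insert.hyps by simp
  also have "\<dots> \<le> (\<Sum>c\<in>G P. card (R c))" by (rule sum_bounded_below[where K = b, simplified]) (rule R)
  also have "\<dots> = card (Sigma (G P) R)" using finG[of P] finR by (simp add: subset_insertI)
  also have "\<dots> = card ((\<lambda>(c, e). c(\<sigma> := e)) ` Sigma (G P) R)"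
  proof (rule card_image[symmetric], rule inj_onI, clarify)
    fix c e c' e' assume *: "c \<in> G P" "c' \<in> G P" "c(\<sigma> := e) = c'(\<sigma> := e')"
    have "c \<sigma> = c' \<sigma>" using *(1,2) insert.hyps by (auto simp: G_def PiE_iff extensional_def)
    moreover have "c \<rho> = c' \<rho>" if "\<rho> \<noteq> \<sigma>" for \<rho> using fun_cong[OF *(3), of \<rho>] that by simp
    ultimately have "c = c'" by (metis ext)
    with fun_cong[OF *(3), of \<sigma>] show "c = c' \<and> e = e'" by simp
  qed
  also have "\<dots> \<le> card (G (insert \<sigma> P))"
  proof (rule card_mono[OF finG], simp, clarify)
    fix c e assume ce: "c \<in> G P" "e \<in> R c"
    have old: "\<xi> ((c(\<sigma> := e)) \<rho>) = \<xi> (c \<rho>)" if "\<rho> \<in> P" for \<rho>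
      using that insert.hyps by auto
    have c: "c \<in> PiE P B" "inj_on (\<lambda>\<rho>. \<xi> (c \<rho>)) P" "\<forall>\<rho>\<in>P. \<xi> (c \<rho>) \<notin> X"
      and e: "e \<in> B \<sigma>" "\<xi> e \<notin> X" "\<xi> e \<notin> (\<lambda>\<rho>. \<xi> (c \<rho>)) ` P"
      using ce by (simp_all add: G_def R_def)
    have "inj_on (\<lambda>\<rho>. \<xi> ((c(\<sigma> := e)) \<rho>)) P" using c(2) old by (simp cong: inj_on_cong)
    moreover have "(\<lambda>\<rho>. \<xi> ((c(\<sigma> := e)) \<rho>)) ` P = (\<lambda>\<rho>. \<xi> (c \<rho>)) ` P"
      using old by (rule image_cong[OF refl])
    ultimately have "inj_on (\<lambda>\<rho>. \<xi> ((c(\<sigma> := e)) \<rho>)) (insert \<sigma> P)"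
      using e(3) insert.hyps by (simp del: fun_upd_apply add: fun_upd_same)
    moreover have "c(\<sigma> := e) \<in> PiE (insert \<sigma> P) B"
      using c(1) e(1) by (simp add: PiE_fun_upd)
    moreover have "\<forall>\<rho>\<in>insert \<sigma> P. \<xi> ((c(\<sigma> := e)) \<rho>) \<notin> X" using c(3) e(2) old by simp
    ultimately show "c(\<sigma> := e) \<in> G (insert \<sigma> P)" unfolding G_def by blast
  qed
  finally show ?case unfolding G_def .
qed simp

section \<open>Extending copies from the shadow\<close>

text \<open>
  Each \<open>P \<in> \<C>\<close> is lifted to the transversals of the fibres of \<open>\<pi>\<close> over \<open>P\<close> whose labels are distinct
  and avoid \<open>X P\<close>. A transversal determines \<open>P\<close> as its image under \<open>\<pi>\<close>, so nothing is counted twice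
  and each \<open>P\<close> contributes at least \<open>(D / 2) ^ l\<close> lifts. A lift containing \<open>I\<close> projects to a member of
  \<open>\<C>\<close> containing \<open>\<pi> ` I\<close>, and only the \<open>l - card I\<close> other fibres remain to be chosen from.
\<close>

lemma extension_family:
  fixes \<pi> :: "'e \<Rightarrow> 's" and \<xi> :: "'e \<Rightarrow> 'x" and D :: real
  assumes "finite E" "finite \<C>"
    and inj: "\<And>\<sigma>. inj_on \<xi> {e \<in> E. \<pi> e = \<sigma>}"
    and P_all: "\<forall>P\<in>\<C>. finite P \<and> card P = l"
    and fibre_all: "\<forall>P\<in>\<C>. \<forall>\<sigma>\<in>P.
      D \<le> real (card {e \<in> E. \<pi> e = \<sigma>}) \<and> real (card {e \<in> E. \<pi> e = \<sigma>}) < 2 * D"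
    and X_all: "\<forall>P\<in>\<C>. finite (X P) \<and> card (X P) \<le> v"
    and D: "2 * real (v + l) \<le> D"
  defines "G \<equiv> \<lambda>P. {c \<in> PiE P (\<lambda>\<sigma>. {e \<in> E. \<pi> e = \<sigma>}). inj_on (\<lambda>\<sigma>. \<xi> (c \<sigma>)) P \<and> (\<forall>\<sigma>\<in>P. \<xi> (c \<sigma>) \<notin> X P)}"
  defines "\<H> \<equiv> \<Union>P\<in>\<C>. (\<lambda>c. c ` P) ` G P"
  shows "finite \<H>" "real (card \<C>) * (D / 2) ^ l \<le> real (card \<H>)"
    "\<And>S. S \<in> \<H> \<Longrightarrow> inj_on \<pi> S"
    "\<And>I. card (\<pi> ` I) = card I \<Longrightarrow>
      real (card {S \<in> \<H>. I \<subseteq> S}) \<le> real (card {P \<in> \<C>. \<pi> ` I \<subseteq> P}) * (2 * D) ^ (l - card I)"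
proof -
  note P = P_all[rule_format] and fibre = fibre_all[rule_format] and X = X_all[rule_format]
  let ?B = "\<lambda>\<sigma>. {e \<in> E. \<pi> e = \<sigma>}"
  have finB: "finite (?B \<sigma>)" for \<sigma> using assms(1) by simp
  have finG: "finite (G P)" if "P \<in> \<C>" for P
  proof -
    have "finite (PiE P ?B)" using P[OF that] finB by (intro finite_PiE) auto
    then show ?thesis by (simp add: G_def)
  qed
  then show fin\<H>: "finite \<H>" using assms(2) by (simp add: \<H>_def)
  have \<pi>c: "\<pi> (c \<sigma>) = \<sigma>" if "c \<in> G P" "\<sigma> \<in> P" for c P \<sigma>
    using that by (auto simp: G_def PiE_iff)
  show "inj_on \<pi> S" if "S \<in> \<H>" for S
    using that \<pi>c by (auto simp: \<H>_def inj_on_def)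
  have Gb: "(D / 2) ^ l \<le> real (card (G P))" if "P \<in> \<C>" for P
  proof -
    define k where "k = nat \<lceil>D\<rceil>"
    have ceil: "D \<le> real k" unfolding k_def by linarith
    define b where "b = k - (v + l)"
    have "real (v + l) \<le> 2 * real (v + l)" by simp
    also note D
    also note ceil
    finally have kvl: "real (v + l) \<le> real k" .
    then have "real b = real k - real (v + l)" unfolding b_def by (simp add: of_nat_diff)
    \<comment> \<open>All fibres have at least \<open>k\<close> elements, of which at most \<open>v + l\<close> are forbidden.\<close>
    then have b: "D / 2 \<le> real b" using D ceil by (simp add: field_simps)
    have "b + card (X P) + card P \<le> card (?B \<sigma>)" if "\<sigma> \<in> P" for \<sigma>
    proof -
      have "k \<le> card (?B \<sigma>)"
        using fibre[OF \<open>P \<in> \<C>\<close> that] by (simp add: k_def nat_le_iff ceiling_le_iff)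
      moreover have "v + l \<le> k" using kvl by simp
      ultimately show ?thesis
        using X[OF \<open>P \<in> \<C>\<close>, THEN conjunct2] P[OF \<open>P \<in> \<C>\<close>, THEN conjunct2]
        unfolding b_def by linarith
    qed
    then have "b ^ card P \<le> card (G P)"
      unfolding G_def using P[OF that] X[OF that] finB inj
      by (intro card_distinct_representatives_ge) auto
    then have "real b ^ l \<le> real (card (G P))" using P[OF that] by (metis of_nat_le_iff of_nat_power)
    moreover have "(D / 2) ^ l \<le> real b ^ l" using b D by (intro power_mono) auto
    ultimately show ?thesis by linarith
  qed
  have \<H>_Sigma: "\<H> = (\<lambda>(P, c). c ` P) ` Sigma \<C> G" by (force simp: \<H>_def)
  have "inj_on (\<lambda>(P, c). c ` P) (Sigma \<C> G)"
  proof (rule inj_onI, clarify)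
    fix P c P' c' assume *: "P \<in> \<C>" "c \<in> G P" "P' \<in> \<C>" "c' \<in> G P'" "c ` P = c' ` P'"
    have "P = \<pi> ` (c ` P)" using \<pi>c[OF *(2)] by force
    also have "\<dots> = P'" unfolding *(5) using \<pi>c[OF *(4)] by force
    finally have PP: "P = P'" .
    have "c = c'"
    proof (rule PiE_ext)
      show "c \<in> PiE P ?B" "c' \<in> PiE P ?B" using *(2,4) PP by (auto simp: G_def)
      fix \<sigma> assume \<sigma>: "\<sigma> \<in> P"
      then obtain \<sigma>' where "\<sigma>' \<in> P" "c \<sigma> = c' \<sigma>'" using *(5) PP by blast
      then show "c \<sigma> = c' \<sigma>" using \<pi>c[OF *(2) \<sigma>] \<pi>c[OF *(4), of \<sigma>'] PP by simp
    qed
    with PP show "P = P' \<and> c = c'" by simp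
  qed
  then have "card \<H> = card (Sigma \<C> G)" unfolding \<H>_Sigma by (rule card_image)
  also have "\<dots> = (\<Sum>P\<in>\<C>. card (G P))" using assms(2) finG by simp
  finally have "real (card \<H>) = (\<Sum>P\<in>\<C>. real (card (G P)))" by simp
  moreover have "real (card \<C>) * (D / 2) ^ l \<le> (\<Sum>P\<in>\<C>. real (card (G P)))"
    by (rule sum_bounded_below) (rule Gb)
  ultimately show "real (card \<C>) * (D / 2) ^ l \<le> real (card \<H>)" by simp
  show "real (card {S \<in> \<H>. I \<subseteq> S}) \<le> real (card {P \<in> \<C>. \<pi> ` I \<subseteq> P}) * (2 * D) ^ (l - card I)"
    if I: "card (\<pi> ` I) = card I" for I
  proof (cases "{S \<in> \<H>. I \<subseteq> S} = {}")
    case True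
    show ?thesis unfolding True using D by simp
  next
    case False
    then obtain S0 where S0: "S0 \<in> \<H>" "I \<subseteq> S0" by blast
    obtain P0 c0 where "P0 \<in> \<C>" "S0 = c0 ` P0" using S0(1) by (auto simp: \<H>_def)
    then have finI: "finite I" using S0(2) P finite_subset[OF S0(2)] by simp
    have inj_I: "inj_on \<pi> I" using finI I by (rule eq_card_imp_inj_on)
    define B' where "B' = (\<lambda>\<sigma>. if \<sigma> \<in> \<pi> ` I then {e \<in> I. \<pi> e = \<sigma>} else ?B \<sigma>)"
    have finB': "finite (B' \<sigma>)" for \<sigma> using finI finB by (simp add: B'_def)
    let ?\<C> = "{P \<in> \<C>. \<pi> ` I \<subseteq> P}"
    have "{S \<in> \<H>. I \<subseteq> S} \<subseteq> (\<lambda>(P, c). c ` P) ` Sigma ?\<C> (\<lambda>P. PiE P B')"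
    proof
      fix S assume "S \<in> {S \<in> \<H>. I \<subseteq> S}"
      then obtain P c where c: "P \<in> \<C>" "c \<in> G P" "S = c ` P" "I \<subseteq> c ` P" by (auto simp: \<H>_def)
      have "\<pi> ` I \<subseteq> P" using c(4) \<pi>c[OF c(2)] by auto
      moreover have "c \<in> PiE P B'"
      proof -
        have "c \<sigma> \<in> B' \<sigma>" if \<sigma>: "\<sigma> \<in> P" for \<sigma>
        proof (cases "\<sigma> \<in> \<pi> ` I")
          case True
          then obtain e where e: "e \<in> I" "\<pi> e = \<sigma>" by blast
          then obtain \<sigma>' where "\<sigma>' \<in> P" "e = c \<sigma>'" using c(4) by blast
          then have "c \<sigma> = e" using \<pi>c[OF c(2), of \<sigma>'] e by simp
          then show ?thesis using True e by (simp add: B'_def)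
        next
          case False
          then show ?thesis using \<sigma> c(2) by (auto simp: B'_def G_def)
        qed
        then show ?thesis using c(2) by (auto simp: G_def PiE_iff)
      qed
      ultimately show "S \<in> (\<lambda>(P, c). c ` P) ` Sigma ?\<C> (\<lambda>P. PiE P B')"
        using c by (intro image_eqI[of _ _ "(P, c)"]) auto
    qed
    moreover have finS: "finite (Sigma ?\<C> (\<lambda>P. PiE P B'))"
      using assms(2) P finB' by (intro finite_SigmaI finite_PiE) auto
    ultimately have "card {S \<in> \<H>. I \<subseteq> S} \<le> card (Sigma ?\<C> (\<lambda>P. PiE P B'))"
      by (meson card_image_le card_mono finite_imageI order_trans)
    also have "\<dots> = (\<Sum>P\<in>?\<C>. \<Prod>\<sigma>\<in>P. card (B' \<sigma>))"
      using assms(2) P finB' by (simp add: card_PiE finite_PiE)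
    finally have "real (card {S \<in> \<H>. I \<subseteq> S}) \<le> real (\<Sum>P\<in>?\<C>. \<Prod>\<sigma>\<in>P. card (B' \<sigma>))"
      by (rule of_nat_mono)
    also have "\<dots> = (\<Sum>P\<in>?\<C>. \<Prod>\<sigma>\<in>P. real (card (B' \<sigma>)))" by simp
    also have "\<dots> \<le> (\<Sum>P\<in>?\<C>. (2 * D) ^ (l - card I))"
    proof (rule sum_mono)
      fix P assume "P \<in> ?\<C>"
      then have PC: "P \<in> \<C>" "\<pi> ` I \<subseteq> P" by auto
      have "(\<Prod>\<sigma>\<in>P. real (card (B' \<sigma>))) \<le> (\<Prod>\<sigma>\<in>P. if \<sigma> \<in> \<pi> ` I then 1 else 2 * D)"
      proof (intro prod_mono conjI)
        fix \<sigma> assume \<sigma>: "\<sigma> \<in> P"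
        show "real (card (B' \<sigma>)) \<le> (if \<sigma> \<in> \<pi> ` I then 1 else 2 * D)"
        proof (cases "\<sigma> \<in> \<pi> ` I")
          case True
          then obtain e where "e \<in> I" "\<pi> e = \<sigma>" by blast
          then have "{e \<in> I. \<pi> e = \<sigma>} = {e}" using inj_I by (auto simp: inj_on_def)
          then show ?thesis using True by (simp add: B'_def)
        next
          case False
          then show ?thesis using fibre[OF PC(1) \<sigma>] by (simp add: B'_def)
        qed
      qed simp
      also have "\<dots> = (\<Prod>\<sigma>\<in>P - \<pi> ` I. 2 * D)"
        using P[OF PC(1)] by (intro prod.mono_neutral_cong_right) auto
      also have "\<dots> = (2 * D) ^ (l - card I)"
        using P[OF PC(1)] PC(2) I finI by (simp add: card_Diff_subset)
      finally show "(\<Prod>\<sigma>\<in>P. real (card (B' \<sigma>))) \<le> (2 * D) ^ (l - card I)" .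
    qed
    also have "\<dots> = real (card ?\<C>) * (2 * D) ^ (l - card I)" by simp
    finally show ?thesis .
  qed
qed

text \<open>
  The vertex by which an edge exceeds the \<open>(r - 1)\<close>-set \<open>\<pi> e\<close> assigned to it.
\<close>

definition apex :: "('b set \<Rightarrow> 'b set) \<Rightarrow> 'b set \<Rightarrow> 'b" where
  "apex \<pi> e = the_elem (e - \<pi> e)"

lemma insert_apex:
  assumes "\<pi> e \<subseteq> e" "Suc (card (\<pi> e)) = card e"
  shows "e = insert (apex \<pi> e) (\<pi> e)"
proof -
  have "finite e" using assms(2) by (intro card_ge_0_finite) simp
  then have "card (e - \<pi> e) = 1"
    using assms finite_subset[OF assms(1)] by (simp add: card_Diff_subset)
  then obtain x where x: "e - \<pi> e = {x}" by (auto simp: card_1_singleton_iff)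
  then have "apex \<pi> e = x" by (simp add: apex_def)
  then show ?thesis using x assms(1) by auto
qed

lemma inj_on_apex:
  assumes "\<And>e. e \<in> E \<Longrightarrow> \<pi> e \<subseteq> e \<and> Suc (card (\<pi> e)) = card e"
  shows "inj_on (apex \<pi>) {e \<in> E. \<pi> e = \<sigma>}"
proof (rule inj_onI)
  fix e e' assume e: "e \<in> {e \<in> E. \<pi> e = \<sigma>}" "e' \<in> {e \<in> E. \<pi> e = \<sigma>}" "apex \<pi> e = apex \<pi> e'"
  have "e = insert (apex \<pi> e) (\<pi> e)" by (rule insert_apex) (use e(1) assms[of e] in auto)
  moreover have "e' = insert (apex \<pi> e') (\<pi> e')" by (rule insert_apex) (use e(2) assms[of e'] in auto)
  ultimately show "e = e'" using e by simp
qed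

text \<open>
  The value \<open>D0\<close> is a quarter of the average number of edges that the at most \<open>n^(r - 1)\<close> sets would
  have if there were \<open>m\<close> edges. Sets with fewer than \<open>D0\<close> edges therefore account for at most \<open>m / 4\<close>
  edges, half of those available, and dyadic selection applies to the remaining sets, as a fibre has
  at most \<open>n\<close> elements.
\<close>

lemma dyadic_shadow:
  fixes A m D0 :: real
  assumes "finite Y" "card Y \<ge> 3" "finite E"
    and E: "\<And>e. e \<in> E \<Longrightarrow> e \<subseteq> Y \<and> card e = r \<and> \<pi> e \<subseteq> e \<and> Suc (card (\<pi> e)) = r"
    and m: "0 < m" "m \<le> 2 * real (card E)"
    and A: "\<And>\<sigma>. real (card {e \<in> E. \<pi> e = \<sigma>}) < A"
    and D0: "D0 = m / (4 * real (card Y) ^ (r - 1))" "1 \<le> D0"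
  obtains \<Sigma> D where "\<Sigma> \<subseteq> \<pi> ` E" "D0 \<le> D" "D < A"
    "\<And>\<sigma>. \<sigma> \<in> \<Sigma> \<Longrightarrow> D \<le> real (card {e \<in> E. \<pi> e = \<sigma>}) \<and> real (card {e \<in> E. \<pi> e = \<sigma>}) < 2 * D"
    "m \<le> 32 * ln (real (card Y)) * real (card \<Sigma>) * D"
proof -
  let ?n = "card Y"
  let ?w = "\<lambda>\<sigma>. real (card {e \<in> E. \<pi> e = \<sigma>})"
  define T where "T = \<pi> ` E"
  have finT: "finite T" using assms(3) by (simp add: T_def)
  have "T \<subseteq> {s. s \<subseteq> Y \<and> card s = r - 1}" using E by (force simp: T_def)
  then have "card T \<le> ?n choose (r - 1)"
    using n_subsets[OF assms(1), of "r - 1"] card_mono[of "{s. s \<subseteq> Y \<and> card s = r - 1}" T] assms(1) by simp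
  also have "\<dots> \<le> ?n ^ (r - 1)"
    by (cases "r - 1 \<le> ?n") (auto intro: binomial_le_pow simp: binomial_eq_0)
  finally have cardT: "real (card T) \<le> real ?n ^ (r - 1)" by (metis of_nat_le_iff of_nat_power)
  define T1 where "T1 = {\<sigma> \<in> T. D0 \<le> ?w \<sigma>}"
  have "real (card E) = (\<Sum>\<sigma>\<in>T. ?w \<sigma>)"
  proof -
    have "card E = (\<Sum>\<sigma>\<in>T. card {e \<in> E. \<pi> e = \<sigma>})"
      unfolding T_def using assms(3) sum.image_gen[of E "\<lambda>_. 1::nat" \<pi>] by simp
    then show ?thesis by simp
  qed
  also have "\<dots> = (\<Sum>\<sigma>\<in>T1. ?w \<sigma>) + (\<Sum>\<sigma>\<in>T - T1. ?w \<sigma>)"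
    using finT by (subst add.commute, intro sum.subset_diff) (auto simp: T1_def)
  also have "(\<Sum>\<sigma>\<in>T - T1. ?w \<sigma>) \<le> real (card (T - T1)) * D0"
    by (rule sum_bounded_above) (auto simp: T1_def)
  also have "\<dots> \<le> real ?n ^ (r - 1) * D0"
  proof (rule mult_right_mono)
    have "real (card (T - T1)) \<le> real (card T)" using finT by (intro of_nat_mono card_mono) auto
    then show "real (card (T - T1)) \<le> real ?n ^ (r - 1)" using cardT by linarith
  qed (use D0 in simp)
  also have "\<dots> = m / 4" using assms(2) D0(1) by simp
  finally have S1: "m / 4 \<le> (\<Sum>\<sigma>\<in>T1. ?w \<sigma>)" using m by linarith
  have finT1: "finite T1" using finT by (simp add: T1_def)
  have "T1 \<noteq> {}" using S1 m by auto
  obtain N where N: "real ?n ^ 1 < 2 ^ N" "real N \<le> (2 * real 1 + 2) * ln (real ?n)"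
    using power_less_two_power_log[OF assms(2)] by blast
  have bnd: "D0 \<le> ?w \<sigma> \<and> ?w \<sigma> < 2 ^ N * D0" if "\<sigma> \<in> T1" for \<sigma>
  proof
    show "D0 \<le> ?w \<sigma>" using that by (simp add: T1_def)
    have "inj_on (apex \<pi>) {e \<in> E. \<pi> e = \<sigma>}" by (rule inj_on_apex) (use E in auto)
    moreover have "apex \<pi> ` {e \<in> E. \<pi> e = \<sigma>} \<subseteq> Y"
    proof clarify
      fix e assume "e \<in> E"
      then show "apex \<pi> e \<in> Y" using insert_apex[of \<pi> e] E[of e] by auto
    qed
    ultimately have "?w \<sigma> \<le> real ?n" using assms(1) by (intro of_nat_mono card_inj_on_le)
    also have "\<dots> < 2 ^ N * 1" using N(1) by simp
    also have "\<dots> \<le> 2 ^ N * D0" using D0(2) by (intro mult_left_mono) auto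
    finally show "?w \<sigma> < 2 ^ N * D0" .
  qed
  have "0 < D0" using D0(2) by simp
  obtain k where k: "sum ?w T1 \<le> real N *
      sum ?w {\<sigma> \<in> T1. 2 ^ k * D0 \<le> ?w \<sigma> \<and> ?w \<sigma> < 2 * (2 ^ k * D0)}"
    using dyadic_class[where w = ?w and N = N, OF finT1 \<open>T1 \<noteq> {}\<close> \<open>0 < D0\<close> bnd] by blast
  define D where "D = 2 ^ k * D0"
  define \<Sigma> where "\<Sigma> = {\<sigma> \<in> T1. D \<le> ?w \<sigma> \<and> ?w \<sigma> < 2 * D}"
  have k': "sum ?w T1 \<le> real N * sum ?w \<Sigma>" using k by (simp add: \<Sigma>_def D_def)
  show thesis
  proof (rule that)
    show "\<Sigma> \<subseteq> \<pi> ` E" by (auto simp: \<Sigma>_def T1_def T_def)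
    show "D0 \<le> D" using \<open>0 < D0\<close> by (simp add: D_def)
    have "\<Sigma> \<noteq> {}" using k' S1 m by (intro notI) simp
    then obtain \<sigma> where "\<sigma> \<in> \<Sigma>" by blast
    then show "D < A" using A[of \<sigma>] by (simp add: \<Sigma>_def)
    show "D \<le> ?w \<sigma> \<and> ?w \<sigma> < 2 * D" if "\<sigma> \<in> \<Sigma>" for \<sigma> using that by (simp add: \<Sigma>_def)
    have w\<Sigma>: "sum ?w \<Sigma> \<le> real (card \<Sigma>) * (2 * D)"
      by (rule sum_bounded_above) (auto simp: \<Sigma>_def)
    have "m / 4 \<le> real N * sum ?w \<Sigma>" using k' S1 by linarith
    also have "\<dots> \<le> real N * (real (card \<Sigma>) * (2 * D))" using w\<Sigma> by (rule mult_left_mono) simp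
    also have "\<dots> \<le> (4 * ln (real ?n)) * (real (card \<Sigma>) * (2 * D))"
      using N(2) \<open>0 < D0\<close> by (intro mult_right_mono) (auto simp: D_def)
    finally show "m \<le> 32 * ln (real ?n) * real (card \<Sigma>) * D" by (simp add: algebra_simps)
  qed
qed

section \<open>Expansions, degrees and density\<close>

lemma r_graph_expansion:
  assumes "r_graph (r - 1) F" "r \<ge> 1"
  shows "r_graph r (expansion F)"
proof -
  have fin: "finite (hverts F)" and e: "\<And>e. e \<in> hedges F \<Longrightarrow> e \<subseteq> hverts F \<and> card e = r - 1"
    using assms(1) by (simp_all add: r_graph_def)
  have "hedges F \<subseteq> Pow (hverts F)" using e by auto
  then have finE: "finite (hedges F)" using fin finite_subset by blast
  have "card (insert (Inr e) (Inl ` e) :: ('a + 'a set) set) = r" if "e \<in> hedges F" for e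
  proof -
    have "finite e" using e[OF that] fin finite_subset by metis
    then show ?thesis using e[OF that] assms(2) by (auto simp: card_insert_if card_image)
  qed
  then show ?thesis using fin finE e by (auto simp: r_graph_def expansion_def)
qed

lemma finite_hedges: "r_graph r H \<Longrightarrow> finite (hedges H)"
  by (rule finite_subset[of _ "Pow (hverts H)"]) (auto simp: r_graph_def)

lemma card_hedges_expansion: "card (hedges (expansion F)) = card (hedges F)"
proof -
  have "inj_on (\<lambda>e. insert (Inr e) (Inl ` e)) (hedges F)"
  proof (rule inj_onI)
    fix e e' :: "'a set"
    assume "insert (Inr e) (Inl ` e) = insert (Inr e') (Inl ` e')"
    then have "(Inr e :: 'a + 'a set) \<in> insert (Inr e') (Inl ` e')" by blast
    then show "e = e'" by auto
  qed
  then show ?thesis by (simp add: expansion_def card_image)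
qed

lemma card_copy:
  assumes "r_graph k F" "S \<in> copies F H"
  shows "card S = card (hedges F)"
proof -
  obtain f where f: "inj_on f (hverts F)" "S = (`) f ` hedges F"
    using assms(2) by (auto simp: copies_def)
  have "inj_on ((`) f) (hedges F)"
    by (rule inj_on_image, rule inj_on_subset[OF f(1)]) (use assms(1) in \<open>auto simp: r_graph_def\<close>)
  then show ?thesis using f(2) by (simp add: card_image)
qed

lemma set_degree_le_max:
  assumes "finite (hverts H)" "S \<subseteq> hverts H" "card S = i"
  shows "set_degree H S \<le> max_set_degree i H"
proof -
  have "finite {set_degree H S |S. S \<subseteq> hverts H \<and> card S = i}" using assms(1) by simp
  then show ?thesis unfolding max_set_degree_def using assms(2,3) by (intro Max_ge) auto
qed

lemma max_set_degree_le:
  fixes b :: real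
  assumes "finite (hverts H)" "i \<le> card (hverts H)"
    and "\<And>S. S \<subseteq> hverts H \<Longrightarrow> card S = i \<Longrightarrow> real (set_degree H S) \<le> b"
  shows "real (max_set_degree i H) \<le> b"
proof -
  let ?D = "{set_degree H S |S. S \<subseteq> hverts H \<and> card S = i}"
  obtain S where "S \<subseteq> hverts H" "card S = i" using obtain_subset_with_card_n[OF assms(2)] by blast
  then have "?D \<noteq> {}" by blast
  moreover have "finite ?D" using assms(1) by simp
  ultimately have "max_set_degree i H \<in> ?D" unfolding max_set_degree_def by (intro Max_in)
  then show ?thesis using assms(3) by auto
qed

text \<open>
  The maximum degree of a non-empty family of non-empty edge sets is at least the average degree,
  and this is at least \<open>card \<C> / card (hedges H)\<close>.
\<close>

lemma degree_factor_ge_1: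
  fixes g :: real
  assumes H: "finite (hedges H)" "hedges H \<noteq> {}"
    and \<C>: "\<C> \<noteq> {}" "finite \<C>" "\<And>S. S \<in> \<C> \<Longrightarrow> S \<noteq> {} \<and> S \<subseteq> hedges H"
    and deg: "real (max_set_degree 1 \<lparr>hverts = hedges H, hedges = \<C>\<rparr>)
      \<le> g * real (card \<C>) / real (card (hedges H))"
  shows "1 \<le> g"
proof -
  let ?deg = "\<lambda>e. card {S \<in> \<C>. {e} \<subseteq> S}"
  have m: "real (card (hedges H)) > 0" using H by (simp add: card_gt_0_iff)
  have "\<C> \<subseteq> (\<Union>e\<in>hedges H. {S \<in> \<C>. {e} \<subseteq> S})" using \<C>(3) by blast
  then have "card \<C> \<le> card (\<Union>e\<in>hedges H. {S \<in> \<C>. {e} \<subseteq> S})"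
    using H(1) \<C>(2) by (intro card_mono) auto
  also have "\<dots> \<le> (\<Sum>e\<in>hedges H. ?deg e)" using H(1) by (rule card_UN_le)
  finally have "real (card \<C>) \<le> real (\<Sum>e\<in>hedges H. ?deg e)" by (rule of_nat_mono)
  also have "\<dots> = (\<Sum>e\<in>hedges H. real (?deg e))" by simp
  also have "\<dots> \<le> real (card (hedges H)) * (g * real (card \<C>) / real (card (hedges H)))"
  proof (rule sum_bounded_above)
    fix e assume "e \<in> hedges H"
    then have "?deg e \<le> max_set_degree 1 \<lparr>hverts = hedges H, hedges = \<C>\<rparr>"
      using set_degree_le_max[of "\<lparr>hverts = hedges H, hedges = \<C>\<rparr>" "{e}" 1] H(1)
      by (simp add: set_degree_def)
    then show "real (?deg e) \<le> g * real (card \<C>) / real (card (hedges H))" using deg by linarith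
  qed
  also have "\<dots> = g * real (card \<C>)" using m by simp
  finally have "1 * real (card \<C>) \<le> g * real (card \<C>)" by simp
  moreover have "real (card \<C>) > 0" using \<C>(1,2) by (simp add: card_gt_0_iff)
  ultimately show ?thesis by (rule mult_right_le_imp_le)
qed

text \<open>
  Two distinct edges span more than \<open>r\<close> vertices, so \<open>F'\<close> with its span takes part in the
  maximum defining the density as soon as \<open>i \<ge> 2\<close>; this gives
  \<open>(i - 1) / d \<le> card (\<Union> F') - r\<close>. For \<open>i = 1\<close> the right-hand side is 1.
\<close>

lemma power_span_le_density:
  assumes X: "r_graph r X" and A: "1 \<le> A"
    and F': "F' \<subseteq> hedges X" "card F' = i" "1 \<le> i"
  shows "(1 / A) ^ (card (\<Union> F') - r) \<le> (A powr (- 1 / r_density r X)) ^ (i - 1)"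
proof (cases "i = 1")
  case True
  then show ?thesis using A by (simp add: power_le_one)
next
  case False
  then have i: "i \<ge> 2" using F' by simp
  have edge: "e \<subseteq> hverts X \<and> card e = r" "finite e" if "e \<in> hedges X" for e
    using X that finite_subset[of e "hverts X"] by (auto simp: r_graph_def)
  have finV: "finite (hverts X)" using X by (simp add: r_graph_def)
  have sub: "\<Union> F' \<subseteq> hverts X" using F'(1) edge by blast
  have finU: "finite (\<Union> F')" using sub finV by (rule finite_subset)
  have span: "r < card (\<Union> F')"
  proof -
    obtain e f where ef: "e \<in> F'" "f \<in> F'" "e \<noteq> f"
      using i F'(2) by (metis card_le_Suc0_iff_eq card.infinite not_less_eq_eq numeral_2_eq_2 zero_le)
    have "\<not> f \<subseteq> e"
      using ef F'(1) edge card_subset_eq[of e f] by (metis subsetD)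
    then have "e \<subset> \<Union> F'" using ef by blast
    then have "card e < card (\<Union> F')" using finU by (rule psubset_card_mono[rotated])
    then show ?thesis using edge ef F'(1) by auto
  qed
  let ?ratio = "\<lambda>Z :: 'a hypergraph. (real (card (hedges Z)) - 1) / (real (card (hverts Z)) - real r)"
  let ?R = "{?ratio Z |Z. subhypergraph Z X \<and> card (hedges Z) \<ge> 2}"
  define d where "d = r_density r X"
  have "finite ?R"
  proof -
    have "?R \<subseteq> ?ratio ` (\<lambda>(V, E). \<lparr>hverts = V, hedges = E\<rparr>) ` (Pow (hverts X) \<times> Pow (hedges X))"
    proof clarify
      fix Z :: "'a hypergraph" assume Z: "subhypergraph Z X" "card (hedges Z) \<ge> 2"
      have "Z = \<lparr>hverts = hverts Z, hedges = hedges Z\<rparr>" by simp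
      then have "Z \<in> (\<lambda>(V, E). \<lparr>hverts = V, hedges = E\<rparr>) ` (Pow (hverts X) \<times> Pow (hedges X))"
        using Z(1) by (intro image_eqI[of _ _ "(hverts Z, hedges Z)"]) (auto simp: subhypergraph_def)
      then show "?ratio Z \<in> ?ratio ` (\<lambda>(V, E). \<lparr>hverts = V, hedges = E\<rparr>) ` (Pow (hverts X) \<times> Pow (hedges X))"
        by (rule imageI)
    qed
    then show ?thesis by (rule finite_subset) (use finV finite_hedges[OF X] in auto)
  qed
  moreover have "(real i - 1) / (real (card (\<Union> F')) - real r) \<in> ?R"
    using sub F' i by (intro CollectI exI[of _ "\<lparr>hverts = \<Union> F', hedges = F'\<rparr>"]) (auto simp: subhypergraph_def)
  ultimately have "(real i - 1) / (real (card (\<Union> F')) - real r) \<le> d"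
    unfolding d_def r_density_def by (rule Max_ge)
  then have d: "real i - 1 \<le> d * (real (card (\<Union> F')) - real r)"
    using span by (simp add: pos_divide_le_eq)
  then have "0 < d * (real (card (\<Union> F')) - real r)" using i by linarith
  then have "0 < d" using span by (simp add: zero_less_mult_iff)
  then have exponent: "(real i - 1) / d \<le> real (card (\<Union> F') - r)"
    using d span by (simp add: pos_divide_le_eq of_nat_diff mult.commute)
  have "(1 / A) ^ (card (\<Union> F') - r) = A powr (- real (card (\<Union> F') - r))"
    using A by (simp add: powr_minus powr_realpow power_one_over inverse_eq_divide)
  also have "\<dots> \<le> A powr (- ((real i - 1) / d))"
    using exponent A by (intro powr_mono) auto
  also have "\<dots> = (A powr (- 1 / d)) ^ (i - 1)"
    using F'(3) A by (simp add: powr_power of_nat_diff)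
  finally show ?thesis by (simp add: d_def)
qed

section \<open>The two cases\<close>

text \<open>
  The case in which half of the edges of \<open>H\<close> survive the cleaning. The constant \<open>K\<close> is the one from
  \<open>spread_family_of_copies\<close>, and the factor 2 accounts for \<open>E'\<close> having only half of the edges.
\<close>

lemma spread_copies_of_large_codegree:
  fixes H :: "'b hypergraph" and F :: "'a hypergraph" and A K :: real
  defines "V \<equiv> hverts (expansion F)" and "\<F> \<equiv> hedges (expansion F)"
  assumes F: "r_graph (r - 1) F" "r \<ge> 2"
    and tree: "tree_sequence r V E Ss" "\<F> \<subseteq> E"
    and H: "r_graph r H" "card (hverts H) \<ge> 3"
    and E': "E' \<subseteq> hedges H" "card (hedges H) > 0" "real (card (hedges H)) \<le> 2 * real (card E')"
    and codegree: "\<And>\<tau>. Suc (card \<tau>) = r \<Longrightarrow> codegree_nbrs E' \<tau> \<noteq> {} \<Longrightarrow>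
      A \<le> real (card (codegree_nbrs E' \<tau>))"
    and A: "1 \<le> A" "2 * real (card V) \<le> A"
    and K: "K = 4 * (real (card V + length Ss) + 1) * 2 ^ length Ss *
      (2 ^ card \<F> * real ((r * card \<F>) ^ card V))"
  obtains \<H> where "\<H> \<noteq> {}" "\<H> \<subseteq> copies (expansion F) H"
    "\<And>I. I \<subseteq> hedges H \<Longrightarrow> 1 \<le> card I \<Longrightarrow> card I \<le> card (hedges F) \<Longrightarrow>
      real (card {S \<in> \<H>. I \<subseteq> S}) \<le> 2 * K * ln (real (card (hverts H))) * real (card \<H>)
        / real (card (hedges H)) * (A powr (- 1 / r_density r (expansion F))) ^ (card I - 1)"
proof -
  interpret codegree_host "hverts H" E' r A
    using H E' A codegree by unfold_locales (auto simp: r_graph_def)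
  have X: "r_graph r (expansion F)" using F by (intro r_graph_expansion) auto
  let ?n = "real (card (hverts H))" and ?m = "real (card (hedges H))"
  have "E' \<noteq> {}" using E' by auto
  have "0 < r" using F by simp
  obtain \<H> where \<H>: "\<H> \<noteq> {}"
    "\<And>S. S \<in> \<H> \<Longrightarrow> \<exists>\<phi>. inj_on \<phi> V \<and> \<phi> ` V \<subseteq> hverts H \<and> S = (`) \<phi> ` \<F> \<and> S \<subseteq> E'"
    "\<And>I \<theta>. finite I \<Longrightarrow> I \<noteq> {} \<Longrightarrow> card I \<le> card \<F> \<Longrightarrow> (\<And>e. e \<in> I \<Longrightarrow> e \<subseteq> hverts H \<and> card e = r)
      \<Longrightarrow> 0 \<le> \<theta> \<Longrightarrow> (\<And>F'. F' \<subseteq> \<F> \<Longrightarrow> card F' = card I \<Longrightarrow> (1 / A) ^ (card (\<Union> F') - r) \<le> \<theta>)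
      \<Longrightarrow> real (card {S \<in> \<H>. I \<subseteq> S}) * real (card E') \<le> K * ln ?n * real (card \<H>) * \<theta>"
    using spread_family_of_copies[OF tree \<open>0 < r\<close> A(2) \<open>E' \<noteq> {}\<close> H(2)] unfolding K by blast
  show thesis
  proof (rule that[OF \<H>(1)])
    show "\<H> \<subseteq> copies (expansion F) H"
    proof
      fix S assume "S \<in> \<H>"
      then obtain \<phi> where "inj_on \<phi> V" "\<phi> ` V \<subseteq> hverts H" "S = (`) \<phi> ` \<F>" "S \<subseteq> E'"
        using \<H>(2) by metis
      then show "S \<in> copies (expansion F) H"
        using E'(1) by (auto simp: copies_def V_def \<F>_def intro!: exI[of _ \<phi>])
    qed
    fix I assume I: "I \<subseteq> hedges H" "1 \<le> card I" "card I \<le> card (hedges F)"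
    define \<theta> where "\<theta> = (A powr (- 1 / r_density r (expansion F))) ^ (card I - 1)"
    let ?d = "real (card {S \<in> \<H>. I \<subseteq> S})"
    have finI: "finite I" using I(2) card_ge_0_finite[of I] by linarith
    have "?d * real (card E') \<le> K * ln ?n * real (card \<H>) * \<theta>"
    proof (rule \<H>(3)[OF finI])
      show "I \<noteq> {}" using I(2) by auto
      show "card I \<le> card \<F>" using I(3) by (simp add: \<F>_def card_hedges_expansion)
      show "e \<subseteq> hverts H \<and> card e = r" if "e \<in> I" for e
        using that I(1) H(1) by (auto simp: r_graph_def)
      show "0 \<le> \<theta>" by (simp add: \<theta>_def)
      show "(1 / A) ^ (card (\<Union> F') - r) \<le> \<theta>" if "F' \<subseteq> \<F>" "card F' = card I" for F'
        unfolding \<theta>_def using that I(2) by (intro power_span_le_density[OF X A(1)]) (auto simp: \<F>_def)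
    qed
    moreover have "?d * ?m \<le> ?d * (2 * real (card E'))" using E'(3) by (rule mult_left_mono) simp
    ultimately have "?d * ?m \<le> 2 * (K * ln ?n * real (card \<H>) * \<theta>)" by linarith
    then have "?d \<le> 2 * (K * ln ?n * real (card \<H>) * \<theta>) / ?m"
      using E'(2) by (simp add: pos_le_divide_eq)
    then show "?d \<le> 2 * K * ln ?n * real (card \<H>) / ?m *
        (A powr (- 1 / r_density r (expansion F))) ^ (card I - 1)"
      by (simp add: \<theta>_def mult.assoc)
  qed
qed

text \<open>
  The case in which half of the edges of \<open>H\<close> are assigned to \<open>(r - 1)\<close>-sets with fewer than \<open>A\<close> edges
  each. If \<open>s\<close> is the number of edges of the shadow selected by \<open>dyadic_shadow\<close>, then
  \<open>1 / (s * D) \<le> 32 ln n / m\<close>, so dividing the degree bound for the shadow by \<open>D ^ i\<close> turns its powers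
  of \<open>1 / s\<close> into powers of \<open>C ln n / m\<close>. The assumption \<open>2 * (v(F) + l) \<le> m / (4 n^(r - 1))\<close> leaves enough
  room to choose new vertices.
\<close>

lemma spread_copies_from_light_shadow:
  fixes H :: "nat hypergraph" and F :: "'a hypergraph" and A C g M :: real and t :: "real \<Rightarrow> real"
  defines "n \<equiv> card (hverts H)" and "m \<equiv> real (card (hedges H))" and "l \<equiv> card (hedges F)"
  assumes F: "r_graph (r - 1) F" "r \<ge> 2" "l \<ge> 1"
    and H: "r_graph r H" "n \<ge> 3" "0 < m"
    and E: "E \<subseteq> hedges H" "m \<le> 2 * real (card E)"
    and \<pi>: "\<And>e. e \<in> E \<Longrightarrow> \<pi> e \<subseteq> e \<and> Suc (card (\<pi> e)) = r"
    and A: "\<And>\<sigma>. real (card {e \<in> E. \<pi> e = \<sigma>}) < A"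
    and D0: "2 * real (card (hverts F) + l) \<le> m / (4 * real n ^ (r - 1))"
    and C: "32 * 4 ^ l \<le> C"
    and M: "0 < M" "M \<le> m / (A * (C * ln (real n)))"
    and g: "0 < g"
    and t_pos: "\<And>x. M \<le> x \<Longrightarrow> 0 < t x"
    and t_mono: "\<And>x y. M \<le> x \<Longrightarrow> x \<le> y \<Longrightarrow> t y \<le> t x"
    and bal: "\<And>G :: nat hypergraph. r_graph (r - 1) G \<Longrightarrow> card (hverts G) = n \<Longrightarrow>
      M \<le> real (card (hedges G)) \<Longrightarrow>
      \<exists>\<C>. \<C> \<noteq> {} \<and> \<C> \<subseteq> copies F G \<and> (\<forall>i. 1 \<le> i \<and> i \<le> l \<longrightarrow>
        real (max_set_degree i \<lparr>hverts = hedges G, hedges = \<C>\<rparr>)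
          \<le> g * real (card \<C>) / real (card (hedges G))
            * (t (real (card (hedges G))) / real (card (hedges G))) ^ (i - 1))"
  obtains \<H> where "\<H> \<noteq> {}" "\<H> \<subseteq> copies (expansion F) H"
    "\<And>I. I \<subseteq> hedges H \<Longrightarrow> 1 \<le> card I \<Longrightarrow> card I \<le> l \<Longrightarrow>
      real (card {S \<in> \<H>. I \<subseteq> S}) \<le> g * (C * ln (real n)) * real (card \<H>) / m
        * (t (m / (A * (C * ln (real n)))) * (C * ln (real n)) / m) ^ (card I - 1)"
proof -
  let ?B = "\<lambda>\<sigma>. {e \<in> E. \<pi> e = \<sigma>}"
  define L where "L = ln (real n)"
  have L: "L > 0" using H(2) by (simp add: L_def)
  have edge: "e \<subseteq> hverts H" "card e = r" if "e \<in> hedges H" for e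
    using H(1) that by (auto simp: r_graph_def)
  have finH: "finite (hverts H)" "finite (hedges H)"
    using H(1) finite_hedges by (auto simp: r_graph_def)
  have finE: "finite E" using E(1) finH(2) by (rule finite_subset)
  have card3: "card (hverts H) \<ge> 3" using H(2) by (simp add: n_def)
  have D01: "1 \<le> m / (4 * real n ^ (r - 1))"
  proof -
    have "1 \<le> 2 * real (card (hverts F) + l)" using F(3) by simp
    then show ?thesis using D0 by linarith
  qed
  obtain \<Sigma> D where \<Sigma>: "\<Sigma> \<subseteq> \<pi> ` E" "m / (4 * real n ^ (r - 1)) \<le> D" "D < A"
    "\<And>\<sigma>. \<sigma> \<in> \<Sigma> \<Longrightarrow> D \<le> real (card (?B \<sigma>)) \<and> real (card (?B \<sigma>)) < 2 * D"
    "m \<le> 32 * ln (real n) * real (card \<Sigma>) * D"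
  proof (rule dyadic_shadow[OF finH(1) card3 finE _ H(3) E(2) A, of r "m / (4 * real n ^ (r - 1))"])
    show "e \<subseteq> hverts H \<and> card e = r \<and> \<pi> e \<subseteq> e \<and> Suc (card (\<pi> e)) = r" if "e \<in> E" for e
      using that \<pi>[OF that] edge E(1) by auto
  qed (use D01 n_def in auto)
  have D: "1 \<le> D" "2 * real (card (hverts F) + l) \<le> D" using \<Sigma>(2) D01 D0 by linarith+
  define s where "s = real (card \<Sigma>)"
  have msD: "m \<le> 32 * L * (s * D)" using \<Sigma>(5) by (simp add: L_def s_def mult.assoc)
  have "0 < 32 * L * (s * D)" using msD H(3) by linarith
  then have sD: "0 < s * D" using L by (simp add: zero_less_mult_iff)
  then have s: "0 < s" using D by (simp add: zero_less_mult_iff)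
  have C32: "32 \<le> C"
  proof -
    have "32 * 1 \<le> 32 * (4::real) ^ l" by (intro mult_left_mono) auto
    then show ?thesis using C by linarith
  qed
  define Z where "Z = m / (A * (C * L))"
  \<comment> \<open>By \<open>D < A\<close> the shadow has enough edges for \<open>F\<close> to be balanced in it.\<close>
  have Zs: "Z \<le> s"
  proof -
    have "m \<le> (s * D) * (32 * L)" using msD by (simp add: mult.commute)
    also have "\<dots> \<le> (s * A) * (C * L)"
      using \<Sigma>(3) C32 s L D by (intro mult_mono mult_left_mono mult_right_mono) auto
    finally have "m \<le> s * (A * (C * L))" by (simp add: mult.assoc)
    moreover have "0 < A * (C * L)" using \<Sigma>(3) D C32 L by simp
    ultimately show ?thesis unfolding Z_def by (simp add: pos_divide_le_eq)
  qed
  have MZ: "M \<le> Z" using M(2) by (simp add: Z_def L_def)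
  define G where "G = \<lparr>hverts = hverts H, hedges = \<Sigma>\<rparr>"
  have "r_graph (r - 1) G"
  proof -
    have "\<sigma> \<subseteq> hverts H \<and> card \<sigma> = r - 1" if \<sigma>: "\<sigma> \<in> \<Sigma>" for \<sigma>
    proof -
      obtain e where e: "e \<in> E" "\<sigma> = \<pi> e" using \<sigma> \<Sigma>(1) by blast
      then show ?thesis using \<pi>[OF e(1)] edge[of e] E(1) by auto
    qed
    then show ?thesis using finH by (simp add: r_graph_def G_def)
  qed
  then obtain \<C> where \<C>: "\<C> \<noteq> {}" "\<C> \<subseteq> copies F G"
    "\<And>i. 1 \<le> i \<Longrightarrow> i \<le> l \<Longrightarrow> real (max_set_degree i \<lparr>hverts = \<Sigma>, hedges = \<C>\<rparr>)
      \<le> g * real (card \<C>) / s * (t s / s) ^ (i - 1)"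
    using bal[of G] MZ Zs by (auto simp: G_def n_def s_def)
  have fin\<Sigma>: "finite \<Sigma>" using \<Sigma>(1) finE finite_surj by blast
  have \<C>_sub: "P \<subseteq> \<Sigma>" "card P = l" if "P \<in> \<C>" for P
    using that \<C>(2) card_copy[OF F(1), of P G] by (auto simp: copies_def G_def l_def)
  have fin\<C>: "finite \<C>" by (rule finite_subset[of _ "Pow \<Sigma>"]) (use \<C>_sub fin\<Sigma> in auto)
  have "\<forall>P\<in>\<C>. \<exists>f. inj_on f (hverts F) \<and> f ` hverts F \<subseteq> hverts H \<and> P = (`) f ` hedges F"
    using \<C>(2) by (auto simp: copies_def G_def)
  then obtain f where f: "\<And>P. P \<in> \<C> \<Longrightarrow>
      inj_on (f P) (hverts F) \<and> f P ` hverts F \<subseteq> hverts H \<and> P = (`) (f P) ` hedges F"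
    by metis
  \<comment> \<open>New vertices must avoid the images of all vertices of \<open>F\<close>, isolated ones included.\<close>
  define X where "X = (\<lambda>P. f P ` hverts F)"
  have F_edge: "finite (hverts F)" "\<And>e. e \<in> hedges F \<Longrightarrow> e \<subseteq> hverts F"
    using F(1) by (auto simp: r_graph_def)
  define Gd where "Gd = (\<lambda>P. {c \<in> PiE P ?B. inj_on (\<lambda>\<sigma>. apex \<pi> (c \<sigma>)) P \<and> (\<forall>\<sigma>\<in>P. apex \<pi> (c \<sigma>) \<notin> X P)})"
  define \<H> where "\<H> = (\<Union>P\<in>\<C>. (\<lambda>c. c ` P) ` Gd P)"
  have pi_edge: "\<pi> e \<subseteq> e \<and> Suc (card (\<pi> e)) = card e" if "e \<in> E" for e
    using \<pi>[OF that] edge[of e] E(1) that by auto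
  have finP: "\<forall>P\<in>\<C>. finite P \<and> card P = l"
    using \<C>_sub finite_subset[OF _ fin\<Sigma>] by simp
  have fibres: "\<forall>P\<in>\<C>. \<forall>\<sigma>\<in>P. D \<le> real (card (?B \<sigma>)) \<and> real (card (?B \<sigma>)) < 2 * D"
    using \<Sigma>(4) \<C>_sub(1) by blast
  have avoid: "\<forall>P\<in>\<C>. finite (X P) \<and> card (X P) \<le> card (hverts F)"
    using F_edge(1) by (simp add: X_def card_image_le)
  have apex_inj: "inj_on (apex \<pi>) (?B \<sigma>)" for \<sigma> by (rule inj_on_apex) (rule pi_edge)
  note ext = extension_family[where l = l and X = X, OF finE fin\<C> apex_inj finP fibres avoid D(2)]
  have ext1: "finite \<H>" "real (card \<C>) * (D / 2) ^ l \<le> real (card \<H>)"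
    unfolding \<H>_def Gd_def by (fact ext(1), fact ext(2))
  have ext2: "inj_on \<pi> S" if "S \<in> \<H>" for S
    using that unfolding \<H>_def Gd_def by (rule ext(3))
  have ext3: "real (card {S \<in> \<H>. I \<subseteq> S}) \<le> real (card {P \<in> \<C>. \<pi> ` I \<subseteq> P}) * (2 * D) ^ (l - card I)"
    if "card (\<pi> ` I) = card I" for I
    using that unfolding \<H>_def Gd_def by (rule ext(4))
  have c: "0 < real (card \<C>)" using \<C>(1) fin\<C> by (simp add: card_gt_0_iff)
  have "0 < real (card \<C>) * (D / 2) ^ l" using c D(1) by simp
  then have "0 < real (card \<H>)" using ext1(2) by linarith
  then have "\<H> \<noteq> {}" by auto
  moreover have "\<H> \<subseteq> copies (expansion F) H"
  proof
    fix S assume "S \<in> \<H>"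
    then obtain P c where Pc: "P \<in> \<C>" "c \<in> Gd P" "S = c ` P" by (auto simp: \<H>_def)
    have fP: "inj_on (f P) (hverts F)" "f P ` hverts F \<subseteq> hverts H" "P = (`) (f P) ` hedges F"
      using f[OF Pc(1)] by auto
    have cE: "c \<sigma> \<in> E" "\<pi> (c \<sigma>) = \<sigma>" if "\<sigma> \<in> P" for \<sigma> using Pc(2) that by (auto simp: Gd_def)
    have c_inj: "inj_on (\<lambda>\<sigma>. apex \<pi> (c \<sigma>)) P" and c_new: "\<And>\<sigma>. \<sigma> \<in> P \<Longrightarrow> apex \<pi> (c \<sigma>) \<notin> f P ` hverts F"
      using Pc(2) by (auto simp: Gd_def X_def)
    have c_eq: "c \<sigma> = insert (apex \<pi> (c \<sigma>)) \<sigma>" if "\<sigma> \<in> P" for \<sigma>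
      using insert_apex[of \<pi> "c \<sigma>"] pi_edge[OF cE(1)[OF that]] cE(2)[OF that] by simp
    have f_edge: "f P ` e \<in> P" if "e \<in> hedges F" for e using fP(3) that by blast
    define \<psi> where "\<psi> = case_sum (f P) (\<lambda>e. apex \<pi> (c (f P ` e)))"
    have "inj_on ((`) (f P)) (hedges F)"
      by (rule inj_on_image, rule inj_on_subset[OF fP(1)]) (use F_edge in auto)
    then have inj2: "inj_on (\<lambda>e. apex \<pi> (c (f P ` e))) (hedges F)"
      using comp_inj_on[of "(`) (f P)" "hedges F" "\<lambda>\<sigma>. apex \<pi> (c \<sigma>)"] c_inj fP(3)[symmetric] by (simp add: o_def)
    have "inj_on \<psi> (hverts (expansion F))"
      unfolding expansion_def hypergraph.simps
    proof (subst inj_on_Un, intro conjI)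
      show "inj_on \<psi> (Inl ` hverts F)" using fP(1) by (auto simp: \<psi>_def inj_on_def)
      show "inj_on \<psi> (Inr ` hedges F)" using inj2 by (auto simp: \<psi>_def inj_on_def)
      show "\<psi> ` (Inl ` hverts F - Inr ` hedges F) \<inter> \<psi> ` (Inr ` hedges F - Inl ` hverts F) = {}"
      proof -
        have "\<psi> ` (Inl ` hverts F - Inr ` hedges F) \<subseteq> f P ` hverts F" by (auto simp: \<psi>_def)
        moreover have "\<psi> ` (Inr ` hedges F - Inl ` hverts F) \<subseteq> (\<lambda>\<sigma>. apex \<pi> (c \<sigma>)) ` P"
          using f_edge by (auto simp: \<psi>_def)
        moreover have "f P ` hverts F \<inter> (\<lambda>\<sigma>. apex \<pi> (c \<sigma>)) ` P = {}"
          unfolding disjoint_iff using c_new by blast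
        ultimately show ?thesis by blast
      qed
    qed
    moreover have "\<psi> ` hverts (expansion F) \<subseteq> hverts H"
    proof -
      have "apex \<pi> (c (f P ` e)) \<in> hverts H" if "e \<in> hedges F" for e
      proof -
        have "apex \<pi> (c (f P ` e)) \<in> c (f P ` e)" using c_eq[OF f_edge[OF that]] by blast
        moreover have "c (f P ` e) \<subseteq> hverts H" using cE(1)[OF f_edge[OF that]] E(1) edge(1) by blast
        ultimately show ?thesis by blast
      qed
      then show ?thesis using fP(2) by (auto simp: expansion_def \<psi>_def)
    qed
    moreover have "S = (`) \<psi> ` hedges (expansion F)"
    proof -
      have "\<psi> ` insert (Inr e) (Inl ` e) = c (f P ` e)" if "e \<in> hedges F" for e
        using c_eq[OF f_edge[OF that]] by (simp add: \<psi>_def image_image)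
      then have "(`) \<psi> ` hedges (expansion F) = (\<lambda>e. c (f P ` e)) ` hedges F"
        by (simp add: expansion_def image_image cong: image_cong)
      also have "\<dots> = c ` ((`) (f P) ` hedges F)" by (simp only: image_image)
      also have "\<dots> = S" using Pc(3) fP(3)[symmetric] by simp
      finally show ?thesis by simp
    qed
    moreover have "S \<subseteq> hedges H" using Pc(3) cE(1) E(1) by auto
    ultimately show "S \<in> copies (expansion F) H" unfolding copies_def by blast
  qed
  moreover have "real (card {S \<in> \<H>. I \<subseteq> S}) \<le> g * (C * L) * real (card \<H>) / m
        * (t Z * (C * L) / m) ^ (card I - 1)"
    if I: "I \<subseteq> hedges H" "1 \<le> card I" "card I \<le> l" for I
  proof (cases "{S \<in> \<H>. I \<subseteq> S} = {}")
    case True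
    have "0 < t Z" using t_pos MZ by simp
    then show ?thesis unfolding True using g C32 L H(3) by simp
  next
    case False
    then obtain S where S: "S \<in> \<H>" "I \<subseteq> S" by blast
    define i where "i = card I"
    have i: "1 \<le> i" "i \<le> l" using I by (auto simp: i_def)
    have \<pi>I: "card (\<pi> ` I) = i" unfolding i_def by (rule card_image, rule inj_on_subset[OF ext2[OF S(1)] S(2)])
    have "\<pi> ` I \<subseteq> \<Sigma>"
    proof -
      obtain P c where "P \<in> \<C>" "c \<in> Gd P" "S = c ` P" using S(1) by (auto simp: \<H>_def)
      then have "\<pi> ` S \<subseteq> P" by (auto simp: Gd_def PiE_iff)
      then show ?thesis using S(2) \<C>_sub(1)[OF \<open>P \<in> \<C>\<close>] by blast
    qed
    then have "card {P \<in> \<C>. \<pi> ` I \<subseteq> P} \<le> max_set_degree i \<lparr>hverts = \<Sigma>, hedges = \<C>\<rparr>"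
      using set_degree_le_max[of "\<lparr>hverts = \<Sigma>, hedges = \<C>\<rparr>" "\<pi> ` I" i] fin\<Sigma> \<pi>I
      by (simp add: set_degree_def)
    then have "real (card {P \<in> \<C>. \<pi> ` I \<subseteq> P}) \<le> g * real (card \<C>) / s * (t s / s) ^ (i - 1)"
      using \<C>(3)[OF i] by linarith
    then have "real (card {P \<in> \<C>. \<pi> ` I \<subseteq> P}) * (2 * D) ^ (l - i)
        \<le> g * real (card \<C>) / s * (t s / s) ^ (i - 1) * (2 * D) ^ (l - i)"
      by (rule mult_right_mono) (use D(1) in simp)
    then have deg: "real (card {S \<in> \<H>. I \<subseteq> S}) \<le> g * real (card \<C>) / s * (t s / s) ^ (i - 1) * (2 * D) ^ (l - i)"
      using ext3[of I] \<pi>I by (simp add: i_def)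
    have ts: "0 < t s" "t s \<le> t Z" using t_pos t_mono MZ Zs by auto
    have Dpow: "(2 * D) ^ (l - i) \<le> 4 ^ l * (D / 2) ^ l / (D * D ^ (i - 1))"
    proof -
      have "(2 * D) ^ (l - i) * (D * D ^ (i - 1)) = 2 ^ (l - i) * (D ^ (l - i) * D ^ i)"
        using i(1) by (cases i) (simp_all add: power_mult_distrib)
      also have "\<dots> = 2 ^ (l - i) * D ^ l" using i(2) by (simp add: power_add[symmetric])
      also have "\<dots> \<le> 2 ^ l * D ^ l" using D(1) by (intro mult_right_mono power_increasing) auto
      also have "\<dots> = (4 * (D / 2)) ^ l" by (simp add: power_mult_distrib)
      also have "\<dots> = 4 ^ l * (D / 2) ^ l" by (rule power_mult_distrib)
      finally show ?thesis using D(1) by (subst pos_le_divide_eq) auto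
    qed
    have "real (card {S \<in> \<H>. I \<subseteq> S})
        \<le> g * real (card \<C>) / s * (t s / s) ^ (i - 1) * (4 ^ l * (D / 2) ^ l / (D * D ^ (i - 1)))"
      using deg mult_left_mono[OF Dpow, of "g * real (card \<C>) / s * (t s / s) ^ (i - 1)"] g c s ts(1)
      by simp
    also have "\<dots> = g * 4 ^ l * (real (card \<C>) * (D / 2) ^ l) * (1 / (s * D)) * (t s * (1 / (s * D))) ^ (i - 1)"
      by (simp add: power_divide power_mult_distrib mult_ac)
    also have "\<dots> \<le> g * 4 ^ l * real (card \<H>) * (32 * L / m) * (t Z * (C * L / m)) ^ (i - 1)"
    proof -
      have inv: "1 / (s * D) \<le> 32 * L / m"
        using msD sD H(3) by (simp add: field_simps)
      also have "\<dots> \<le> C * L / m" using C32 L H(3) by (intro divide_right_mono mult_right_mono) auto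
      finally have "t s * (1 / (s * D)) \<le> t Z * (C * L / m)"
        using ts sD C32 L H(3) by (intro mult_mono) auto
      then have pow: "(t s * (1 / (s * D))) ^ (i - 1) \<le> (t Z * (C * L / m)) ^ (i - 1)"
        using ts sD by (intro power_mono) auto
      show ?thesis
        using g ext1(2) inv pow sD ts D(1) L H(3) C32
        by (intro mult_mono) (auto intro!: mult_nonneg_nonneg)
    qed
    also have "\<dots> = g * (32 * 4 ^ l * L) * real (card \<H>) / m * (t Z * (C * L) / m) ^ (i - 1)"
      by simp
    also have "\<dots> \<le> g * (C * L) * real (card \<H>) / m * (t Z * (C * L) / m) ^ (i - 1)"
      using g C L H(3) ts C32
      by (intro mult_right_mono divide_right_mono mult_left_mono) auto
    finally show ?thesis by (simp add: i_def)
  qed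
  ultimately show thesis using that unfolding Z_def L_def by blast
qed

section \<open>Combining the two cases\<close>

text \<open>
  The bound \<open>binomial n k \<ge> (n / k)^k\<close> loses only the factor \<open>k^k\<close>, which \<open>C * ln n\<close> absorbs.
\<close>

lemma complete_r_graph:
  fixes M C :: real
  assumes "1 \<le> k" "k \<le> n" "3 \<le> n" "real k ^ k \<le> C" "M * (C * ln (real n)) \<le> real n ^ k"
  obtains G :: "nat hypergraph" where "r_graph k G" "card (hverts G) = n" "hedges G \<noteq> {}"
    "M \<le> real (card (hedges G))"
proof
  let ?G = "\<lparr>hverts = {..<n}, hedges = {e. e \<subseteq> {..<n} \<and> card e = k}\<rparr>"
  show "r_graph k ?G" "card (hverts ?G) = n" by (auto simp: r_graph_def)
  have card: "card (hedges ?G) = n choose k" by (simp add: n_subsets)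
  have "card (hedges ?G) \<noteq> 0" unfolding card using assms(2) by simp
  then show "hedges ?G \<noteq> {}" by (metis card.empty)
  have kk: "0 < real k ^ k" using assms(1) by simp
  have ln1: "1 \<le> ln (real n)"
    using assms(3) exp_le by (subst ln_ge_iff) (auto intro: order_trans)
  show "M \<le> real (card (hedges ?G))"
  proof (cases "M \<le> 0")
    case True
    then show ?thesis by (rule order_trans) simp
  next
    case False
    have "real k ^ k * 1 \<le> C * ln (real n)"
      using assms(4) ln1 kk by (intro mult_mono) linarith+
    then have "M * (real k ^ k) \<le> M * (C * ln (real n))" using False by (intro mult_left_mono) auto
    also have "\<dots> \<le> real n ^ k" by (rule assms(5))
    finally have "M \<le> real n ^ k / real k ^ k" using kk by (simp add: pos_le_divide_eq)
    also have "\<dots> = (real n / real k) ^ k" by (simp add: power_divide)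
    also have "\<dots> \<le> real (n choose k)" using binomial_ge_n_over_k_pow_k[OF assms(2), where 'a = real] by simp
    finally show ?thesis using card by simp
  qed
qed

text \<open>
  The whole argument for one host hypergraph, with \<open>a\<close> for the value \<open>A n m\<close> and \<open>t\<close> for \<open>\<tau> n\<close>. Since
  \<open>a \<ge> m / n^(r - 1) \<ge> C\<close>, a large \<open>C\<close> makes both the codegrees that survive the cleaning and the
  selected fibres as large as needed.
\<close>

lemma spread_copies_of_expansion:
  fixes F :: "'a hypergraph" and H :: "nat hypergraph" and M g a C K :: real and t :: "real \<Rightarrow> real"
  defines "n \<equiv> card (hverts H)" and "m \<equiv> real (card (hedges H))" and "l \<equiv> card (hedges F)"
    and "V \<equiv> hverts (expansion F)"
  assumes F: "r_graph (r - 1) F" "r \<ge> 2" "l \<ge> 1"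
    and tree: "tree_sequence r V E Ss" "hedges (expansion F) \<subseteq> E"
    and K: "K = 4 * (real (card V + length Ss) + 1) * 2 ^ length Ss *
      (2 ^ card (hedges (expansion F)) * real ((r * card (hedges (expansion F))) ^ card V))"
    and C: "32 * 4 ^ l \<le> C" "2 * K \<le> C" "2 * real (card V) \<le> C" "8 * real (card (hverts F) + l) \<le> C"
    and H: "r_graph r H" "n \<ge> 3" "C * real n ^ (r - 1) \<le> m"
    and M: "0 < M" and g: "1 \<le> g"
    and a: "m / real n ^ (r - 1) \<le> a" "a \<le> m / (M * (C * ln (real n)))"
    and t_pos: "\<And>x. M \<le> x \<Longrightarrow> 0 < t x"
    and t_mono: "\<And>x y. M \<le> x \<Longrightarrow> x \<le> y \<Longrightarrow> t y \<le> t x"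
    and bal: "\<And>G :: nat hypergraph. r_graph (r - 1) G \<Longrightarrow> card (hverts G) = n \<Longrightarrow>
      M \<le> real (card (hedges G)) \<Longrightarrow>
      \<exists>\<C>. \<C> \<noteq> {} \<and> \<C> \<subseteq> copies F G \<and> (\<forall>i. 1 \<le> i \<and> i \<le> l \<longrightarrow>
        real (max_set_degree i \<lparr>hverts = hedges G, hedges = \<C>\<rparr>)
          \<le> g * real (card \<C>) / real (card (hedges G))
            * (t (real (card (hedges G))) / real (card (hedges G))) ^ (i - 1))"
  shows "\<exists>\<H>. \<H> \<noteq> {} \<and> \<H> \<subseteq> copies (expansion F) H \<and> (\<forall>i. 1 \<le> i \<and> i \<le> l \<longrightarrow>
        real (max_set_degree i \<lparr>hverts = hedges H, hedges = \<H>\<rparr>)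
          \<le> g * (C * ln (real n)) * real (card \<H>) / m
            * (max (a powr (- 1 / r_density r (expansion F)) * m)
                  (t (m / (a * (C * ln (real n)))) * (C * ln (real n))) / m) ^ (i - 1))"
proof -
  define L where "L = ln (real n)"
  have L: "0 < L" using H(2) by (simp add: L_def)
  define \<alpha> where "\<alpha> = a powr (- 1 / r_density r (expansion F))"
  define \<beta> where "\<beta> = t (m / (a * (C * L))) * (C * L)"
  define \<T> where "\<T> = max (\<alpha> * m) \<beta>"
  have C1: "1 \<le> C"
  proof -
    have "32 * 1 \<le> 32 * (4::real) ^ l" by (intro mult_left_mono) auto
    then show ?thesis using C(1) by linarith
  qed
  have n: "0 < real n ^ (r - 1)" using H(2) by simp
  have Cn: "C \<le> m / real n ^ (r - 1)" using H(3) n by (simp add: pos_le_divide_eq)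
  have a_ge: "C \<le> a" using Cn a(1) by linarith
  have m: "0 < m" using Cn C1 n by (smt (verit) divide_nonpos_pos)
  have finH: "finite (hedges H)" using H(1) by (rule finite_hedges)
  have CL: "C * L > 0" using C1 L by simp
  have Ma: "M \<le> m / (a * (C * L))"
  proof -
    have "a * (M * (C * L)) \<le> m"
      using a(2) M CL unfolding L_def[symmetric] by (simp add: pos_le_divide_eq)
    then have "M * (a * (C * L)) \<le> m" by (simp add: mult_ac)
    moreover have "0 < a * (C * L)" using a_ge C1 CL by simp
    ultimately show ?thesis by (simp add: pos_le_divide_eq)
  qed
  have edge: "finite e \<and> card e = r" if "e \<in> hedges H" for e
    using H(1) that finite_subset[of e "hverts H"] by (auto simp: r_graph_def)
  have X: "r_graph r (expansion F)" using F by (intro r_graph_expansion) auto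
  have a0: "0 < a" using a_ge C1 by linarith
  have \<alpha>0: "0 \<le> \<alpha>" by (simp add: \<alpha>_def)
  have \<alpha>\<T>: "\<alpha> \<le> \<T> / m" using m by (simp add: \<T>_def pos_le_divide_eq)
  have \<beta>0: "0 \<le> \<beta>" using t_pos[OF Ma] CL by (simp add: \<beta>_def)
  have \<beta>\<T>: "\<beta> / m \<le> \<T> / m" using m by (simp add: \<T>_def divide_right_mono)
  obtain E' \<pi> where cleaned: "E' \<subseteq> hedges H"
    "\<forall>\<tau>. Suc (card \<tau>) = r \<longrightarrow> codegree_nbrs E' \<tau> \<noteq> {} \<longrightarrow> a \<le> real (card (codegree_nbrs E' \<tau>))"
    "\<forall>e\<in>hedges H - E'. \<pi> e \<subseteq> e \<and> Suc (card (\<pi> e)) = r"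
    "\<forall>\<tau>. real (card {e \<in> hedges H - E'. \<pi> e = \<tau>}) < a"
    by (rule exE[OF codegree_cleaning[OF finH _ a0]]) (rule edge, assumption, elim exE conjE, rule that)
  note E' = cleaned(1) cleaned(2-4)[rule_format]
  have "\<exists>\<H>. \<H> \<noteq> {} \<and> \<H> \<subseteq> copies (expansion F) H \<and>
    (\<forall>I. I \<subseteq> hedges H \<longrightarrow> 1 \<le> card I \<longrightarrow> card I \<le> l \<longrightarrow>
      real (card {S \<in> \<H>. I \<subseteq> S}) \<le> g * (C * L) * real (card \<H>) / m * (\<T> / m) ^ (card I - 1))"
  proof (cases "m \<le> 2 * real (card E')")
    case True
    obtain \<H> where \<H>: "\<H> \<noteq> {}" "\<H> \<subseteq> copies (expansion F) H"
      "\<And>I. I \<subseteq> hedges H \<Longrightarrow> 1 \<le> card I \<Longrightarrow> card I \<le> l \<Longrightarrow>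
        real (card {S \<in> \<H>. I \<subseteq> S}) \<le> 2 * K * L * real (card \<H>) / m * \<alpha> ^ (card I - 1)"
    proof (rule spread_copies_of_large_codegree[OF F(1,2) tree[unfolded V_def] H(1) _ E'(1) _ _ E'(2) _ _ K[unfolded V_def]])
      show "3 \<le> card (hverts H)" using H(2) by (simp add: n_def)
      show "0 < card (hedges H)" using m by (simp add: m_def)
      show "real (card (hedges H)) \<le> 2 * real (card E')" using True by (simp add: m_def)
      show "1 \<le> a" "2 * real (card (hverts (expansion F))) \<le> a"
        using a_ge C1 C(3) by (auto simp: V_def)
    qed (use that in \<open>auto simp: L_def n_def m_def l_def \<alpha>_def\<close>)
    have "real (card {S \<in> \<H>. I \<subseteq> S}) \<le> g * (C * L) * real (card \<H>) / m * (\<T> / m) ^ (card I - 1)"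
      if I: "I \<subseteq> hedges H" "1 \<le> card I" "card I \<le> l" for I
    proof -
      have "2 * K * L \<le> C * L" using C(2) L by (intro mult_right_mono) auto
      also have "\<dots> = 1 * (C * L)" by simp
      also have "\<dots> \<le> g * (C * L)" using g CL by (intro mult_right_mono) auto
      finally have "2 * K * L * real (card \<H>) / m \<le> g * (C * L) * real (card \<H>) / m"
        using m by (intro divide_right_mono mult_right_mono) auto
      moreover have "\<alpha> ^ (card I - 1) \<le> (\<T> / m) ^ (card I - 1)" using \<alpha>\<T> \<alpha>0 by (rule power_mono)
      ultimately have "2 * K * L * real (card \<H>) / m * \<alpha> ^ (card I - 1)
          \<le> g * (C * L) * real (card \<H>) / m * (\<T> / m) ^ (card I - 1)"
        using g CL m \<alpha>0 by (intro mult_mono) auto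
      then show ?thesis using \<H>(3)[OF I] by linarith
    qed
    then show ?thesis using \<H>(1,2) by blast
  next
    case False
    have "real (card (hedges H - E')) = m - real (card E')"
      using E'(1) finH card_mono[OF finH E'(1)] finite_subset[OF E'(1) finH]
      by (simp add: card_Diff_subset m_def of_nat_diff)
    then have E: "m \<le> 2 * real (card (hedges H - E'))" using False by linarith
    obtain \<H> where \<H>: "\<H> \<noteq> {}" "\<H> \<subseteq> copies (expansion F) H"
      "\<And>I. I \<subseteq> hedges H \<Longrightarrow> 1 \<le> card I \<Longrightarrow> card I \<le> l \<Longrightarrow>
        real (card {S \<in> \<H>. I \<subseteq> S}) \<le> g * (C * L) * real (card \<H>) / m * (\<beta> / m) ^ (card I - 1)"
    proof (rule spread_copies_from_light_shadow[of r F H "hedges H - E'" \<pi> a C M g t,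
        folded n_def m_def l_def L_def, folded \<beta>_def])
      show "2 * real (card (hverts F) + l) \<le> m / (4 * real n ^ (r - 1))"
      proof -
        have "8 * real (card (hverts F) + l) \<le> m / real n ^ (r - 1)" using C(4) Cn by linarith
        then show ?thesis using n by (simp add: field_simps)
      qed
      show "0 < g" using g by linarith
    qed (rule F H(1,2) m E E'(3,4) C(1) M Ma t_mono t_pos bal that Diff_subset | assumption)+
    have "real (card {S \<in> \<H>. I \<subseteq> S}) \<le> g * (C * L) * real (card \<H>) / m * (\<T> / m) ^ (card I - 1)"
      if I: "I \<subseteq> hedges H" "1 \<le> card I" "card I \<le> l" for I
    proof -
      have "(\<beta> / m) ^ (card I - 1) \<le> (\<T> / m) ^ (card I - 1)"
        using \<beta>\<T> \<beta>0 m by (intro power_mono) auto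
      then have "g * (C * L) * real (card \<H>) / m * (\<beta> / m) ^ (card I - 1)
          \<le> g * (C * L) * real (card \<H>) / m * (\<T> / m) ^ (card I - 1)"
        using g CL m by (intro mult_left_mono) auto
      then show ?thesis using \<H>(3)[OF I] by linarith
    qed
    then show ?thesis using \<H>(1,2) by blast
  qed
  then obtain \<H> where spread: "\<H> \<noteq> {}" "\<H> \<subseteq> copies (expansion F) H"
    "\<forall>I. I \<subseteq> hedges H \<longrightarrow> 1 \<le> card I \<longrightarrow> card I \<le> l \<longrightarrow>
      real (card {S \<in> \<H>. I \<subseteq> S}) \<le> g * (C * L) * real (card \<H>) / m * (\<T> / m) ^ (card I - 1)"
    by (elim exE conjE) (rule that)
  note \<H> = spread(1,2) spread(3)[rule_format]
  have "l \<le> card (hedges H)"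
  proof -
    obtain S where "S \<in> copies (expansion F) H" using \<H>(1,2) by blast
    then have "card S = l" "S \<subseteq> hedges H"
      using card_copy[OF X] by (auto simp: l_def card_hedges_expansion copies_def)
    then show ?thesis using card_mono[OF finH] by metis
  qed
  then have "real (max_set_degree i \<lparr>hverts = hedges H, hedges = \<H>\<rparr>)
      \<le> g * (C * L) * real (card \<H>) / m * (\<T> / m) ^ (i - 1)" if "1 \<le> i" "i \<le> l" for i
    using that finH \<H>(3) by (intro max_set_degree_le) (auto simp: set_degree_def)
  then show ?thesis
    using \<H>(1,2) unfolding \<T>_def \<alpha>_def \<beta>_def L_def by blast
qed

text \<open>
  The constant is a sum with one term for each requirement of \<open>spread_copies_of_expansion\<close> and
  \<open>complete_r_graph\<close>. It depends on \<open>F\<close>, \<open>r\<close> and one chosen tight tree.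
\<close>

theorem theorem2p8:
  fixes F :: "'a hypergraph" and r :: nat
  assumes "r_graph (r - 1) F"
    and "r - 1 \<ge> 2"
    and "card (hedges F) \<ge> 2"
    and "\<exists>T. tight_tree r T \<and> spanning_subhypergraph (expansion F) T"
  shows "\<exists>C::real. C > 0 \<and>
    (\<forall>(M :: real \<Rightarrow> real) (\<gamma> :: real \<Rightarrow> real) (\<tau> :: real \<Rightarrow> real \<Rightarrow> real)
      (A :: real \<Rightarrow> real \<Rightarrow> real).
       balanced (r - 1) M \<gamma> \<tau> F \<and>
       (\<exists>n0. mono_on {n0..} \<gamma>) \<and>
       (\<exists>n0. (\<forall>m. mono_on {n. n \<ge> n0 \<and> m \<ge> M n} (\<lambda>n. \<tau> n m)) \<and>
             (\<forall>n\<ge>n0. antimono_on {m. m \<ge> M n} (\<lambda>m. \<tau> n m))) \<and>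
       (\<forall>\<^sub>F n in at_top. \<forall>m \<ge> C * n ^ (r - 1).
          m * n powr (1 - real r) \<le> A n m \<and> A n m \<le> m / (M n * (C * ln n)))
       \<longrightarrow>
       balanced r
         (\<lambda>n. C * n ^ (r - 1))
         (\<lambda>n. \<gamma> n * (C * ln n))
         (\<lambda>n m. max (A n m powr (- 1 / r_density r (expansion F)) * m)
                     (\<tau> n (m / (A n m * (C * ln n))) * (C * ln n)))
         (expansion F))"
proof -
  obtain T where T: "tight_tree r T" "spanning_subhypergraph (expansion F) T" using assms(4) by blast
  have V: "hverts T = hverts (expansion F)" and sub: "hedges (expansion F) \<subseteq> hedges T"
    using T(2) by (auto simp: spanning_subhypergraph_def subhypergraph_def)
  have "hedges T \<noteq> {}"
  proof -
    have "card (hedges (expansion F)) \<ge> 2" using assms(3) by (simp add: card_hedges_expansion)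
    then show ?thesis using sub by auto
  qed
  then obtain Ss where tree: "tree_sequence r (hverts (expansion F)) (hedges T) Ss"
    using tight_tree_sequence[OF T(1)] assms(2) V by force
  define l where "l = card (hedges F)"
  define v where "v = card (hverts (expansion F))"
  define K where "K = 4 * (real (v + length Ss) + 1) * 2 ^ length Ss *
      (2 ^ card (hedges (expansion F)) * real ((r * card (hedges (expansion F))) ^ v))"
  define C where "C = 32 * 4 ^ l + 2 * K + 2 * real v + 8 * real (card (hverts F) + l) + real (r - 1) ^ (r - 1)"
  have K0: "0 \<le> K" by (simp add: K_def)
  have p: "0 \<le> real v" "0 \<le> real (card (hverts F) + l)" "0 \<le> real (r - 1) ^ (r - 1)" "0 < (4::real) ^ l" by auto
  have C: "32 * 4 ^ l \<le> C" "2 * K \<le> C" "2 * real v \<le> C"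
    "8 * real (card (hverts F) + l) \<le> C" "real (r - 1) ^ (r - 1) \<le> C" "0 < C"
    unfolding C_def using p K0 by argo+
  show ?thesis
  proof (intro exI[of _ C] conjI allI impI, rule C(6), elim conjE exE)
    fix M \<gamma> :: "real \<Rightarrow> real" and \<tau> A :: "real \<Rightarrow> real \<Rightarrow> real" and n0 n1 :: real
    assume bal: "balanced (r - 1) M \<gamma> \<tau> F"
      and anti: "\<forall>n\<ge>n1. antimono_on {m. m \<ge> M n} (\<lambda>m. \<tau> n m)"
      and A: "\<forall>\<^sub>F n in at_top. \<forall>m \<ge> C * n ^ (r - 1).
          m * n powr (1 - real r) \<le> A n m \<and> A n m \<le> m / (M n * (C * ln n))"
    let ?M = "\<lambda>n. C * n ^ (r - 1)"
    let ?\<gamma> = "\<lambda>n. \<gamma> n * (C * ln n)"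
    let ?\<tau> = "\<lambda>n m. max (A n m powr (- 1 / r_density r (expansion F)) * m)
                     (\<tau> n (m / (A n m * (C * ln n))) * (C * ln n))"
    have pos: "\<forall>\<^sub>F n in at_top. M n > 0 \<and> \<gamma> n > 0 \<and> (\<forall>m\<ge>M n. \<tau> n m > 0)"
      using bal by (simp add: balanced_def positive_parameters_def)
    have "\<forall>\<^sub>F n in at_top. ?M n > 0 \<and> ?\<gamma> n > 0 \<and> (\<forall>m\<ge>?M n. ?\<tau> n m > 0)"
      using pos A eventually_gt_at_top[of 1]
    proof eventually_elim
      case (elim n)
      have M: "?M n > 0" using elim C(6) by simp
      moreover have "?\<gamma> n > 0" using elim C(6) by simp
      moreover have "?\<tau> n m > 0" if "m \<ge> ?M n" for m
      proof -
        have m: "m > 0" using that M by linarith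
        then have "0 < m * n powr (1 - real r)" using elim by simp
        then have "0 < A n m" using elim that by fastforce
        then have "0 < A n m powr (- 1 / r_density r (expansion F)) * m" using m by simp
        then show ?thesis by (simp add: less_max_iff_disj)
      qed
      ultimately show ?case by blast
    qed
    then have positive: "positive_parameters ?M ?\<gamma> ?\<tau>" by (simp add: positive_parameters_def)
    define P where "P = (\<lambda>n::real. \<forall>m \<ge> C * n ^ (r - 1).
          m * n powr (1 - real r) \<le> A n m \<and> A n m \<le> m / (M n * (C * ln n)))"
    have seq: "filterlim real at_top sequentially" by (rule filterlim_real_sequentially)
    have large: "\<forall>\<^sub>F n in sequentially. \<forall>m. \<forall>G :: nat hypergraph.
        r_graph (r - 1) G \<and> card (hverts G) = n \<and> card (hedges G) = m \<and> real m \<ge> M (real n) \<longrightarrow>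
        (\<exists>\<C>. \<C> \<noteq> {} \<and> \<C> \<subseteq> copies F G \<and>
          (\<forall>i. 1 \<le> i \<and> i \<le> card (hedges F) \<longrightarrow>
             real (max_set_degree i \<lparr>hverts = hedges G, hedges = \<C>\<rparr>)
               \<le> \<gamma> (real n) * real (card \<C>) / real m * (\<tau> (real n) (real m) / real m) ^ (i - 1)))"
      using bal by (simp add: balanced_def)
    have "\<forall>\<^sub>F n in sequentially. \<forall>m. \<forall>H :: nat hypergraph.
        r_graph r H \<and> card (hverts H) = n \<and> card (hedges H) = m \<and> real m \<ge> ?M (real n) \<longrightarrow>
        (\<exists>\<C>. \<C> \<noteq> {} \<and> \<C> \<subseteq> copies (expansion F) H \<and>
          (\<forall>i. 1 \<le> i \<and> i \<le> card (hedges (expansion F)) \<longrightarrow>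
             real (max_set_degree i \<lparr>hverts = hedges H, hedges = \<C>\<rparr>)
               \<le> ?\<gamma> (real n) * real (card \<C>) / real m * (?\<tau> (real n) (real m) / real m) ^ (i - 1)))"
      using large eventually_compose_filterlim[OF pos seq]
        eventually_compose_filterlim[OF A[folded P_def] seq]
        eventually_compose_filterlim[OF eventually_ge_at_top[of n1] seq]
        eventually_ge_at_top[of 3] eventually_ge_at_top[of "r - 1"]
    proof eventually_elim
      case (elim n)
      have P: "m * real n powr (1 - real r) \<le> A (real n) m"
        "A (real n) m \<le> m / (M (real n) * (C * ln (real n)))" if "C * real n ^ (r - 1) \<le> m" for m
        using elim(3) that by (auto simp: P_def)
      have bal_n: "\<exists>\<C>. \<C> \<noteq> {} \<and> \<C> \<subseteq> copies F G \<and> (\<forall>i. 1 \<le> i \<and> i \<le> l \<longrightarrow>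
          real (max_set_degree i \<lparr>hverts = hedges G, hedges = \<C>\<rparr>)
            \<le> \<gamma> (real n) * real (card \<C>) / real (card (hedges G))
              * (\<tau> (real n) (real (card (hedges G))) / real (card (hedges G))) ^ (i - 1))"
        if "r_graph (r - 1) G" "card (hverts G) = n" "M (real n) \<le> real (card (hedges G))"
        for G :: "nat hypergraph"
        using elim(1) that by (auto simp: l_def)
      have n: "0 < real n ^ (r - 1)" using elim(5) by simp
      have powr: "real n powr (1 - real r) = 1 / real n ^ (r - 1)"
      proof -
        have "1 - real r = - real (r - 1)" using assms(2) by (simp add: of_nat_diff)
        then have "real n powr (1 - real r) = inverse (real n powr real (r - 1))"
          by (simp only: powr_minus)
        also have "real n powr real (r - 1) = real n ^ (r - 1)"
          using elim(5) by (intro powr_realpow) simp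
        finally show ?thesis by (simp only: inverse_eq_divide)
      qed
      have CL: "0 < C * ln (real n)" using C(6) elim(5) by simp
      \<comment> \<open>Comparing the two bounds on \<open>A\<close> at one admissible value of \<open>m\<close>.\<close>
      have "M (real n) * (C * ln (real n)) \<le> real n ^ (r - 1)"
      proof -
        define N where "N = real n ^ (r - 1)"
        define Q where "Q = M (real n) * (C * ln (real n))"
        have N: "0 < N" using n by (simp only: N_def)
        have Q: "0 < Q" using elim(2) CL by (simp add: Q_def)
        have "C * N * (1 / N) \<le> C * N / Q"
          unfolding N_def Q_def powr[symmetric]
          by (rule order_trans[OF P(1)[OF order_refl] P(2)[OF order_refl]])
        then have "C * Q \<le> C * N" using N Q by (simp add: pos_le_divide_eq)
        then have "Q \<le> N" using C(6) by simp
        then show ?thesis by (simp only: N_def Q_def)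
      qed
      then obtain G :: "nat hypergraph" where G: "r_graph (r - 1) G" "card (hverts G) = n"
        "hedges G \<noteq> {}" "M (real n) \<le> real (card (hedges G))"
        using complete_r_graph[of "r - 1" n C "M (real n)"] assms(2) elim(5,6) C(5) by auto
      obtain \<C> where \<C>: "\<C> \<noteq> {}" "\<C> \<subseteq> copies F G"
        "real (max_set_degree 1 \<lparr>hverts = hedges G, hedges = \<C>\<rparr>)
            \<le> \<gamma> (real n) * real (card \<C>) / real (card (hedges G))"
      proof -
        obtain \<C> where "\<C> \<noteq> {} \<and> \<C> \<subseteq> copies F G \<and> (\<forall>i. 1 \<le> i \<and> i \<le> l \<longrightarrow>
          real (max_set_degree i \<lparr>hverts = hedges G, hedges = \<C>\<rparr>)
            \<le> \<gamma> (real n) * real (card \<C>) / real (card (hedges G))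
              * (\<tau> (real n) (real (card (hedges G))) / real (card (hedges G))) ^ (i - 1))"
          using bal_n[OF G(1,2,4)] by blast
        moreover have "1 \<le> l" using assms(3) by (simp add: l_def)
        ultimately show ?thesis using that[of \<C>] by fastforce
      qed
      have finG: "finite (hedges G)" using G(1) by (rule finite_hedges)
      have \<C>_edges: "S \<noteq> {} \<and> S \<subseteq> hedges G" if "S \<in> \<C>" for S
      proof -
        have S: "S \<in> copies F G" using that \<C>(2) by blast
        then have "card S \<noteq> 0" using card_copy[OF assms(1) S] assms(3) by simp
        then show ?thesis using S by (auto simp: copies_def)
      qed
      have "finite \<C>" by (rule finite_subset[of _ "Pow (hedges G)"]) (use \<C>_edges finG in auto)
      then have \<gamma>: "1 \<le> \<gamma> (real n)"
        using degree_factor_ge_1[OF finG G(3) \<C>(1) _ \<C>_edges \<C>(3)] by blast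
      show ?case
      proof (intro allI impI, elim conjE)
        fix m and H :: "nat hypergraph"
        assume H: "r_graph r H" "card (hverts H) = n" "card (hedges H) = m" "?M (real n) \<le> real m"
        show "\<exists>\<C>. \<C> \<noteq> {} \<and> \<C> \<subseteq> copies (expansion F) H \<and>
          (\<forall>i. 1 \<le> i \<and> i \<le> card (hedges (expansion F)) \<longrightarrow>
             real (max_set_degree i \<lparr>hverts = hedges H, hedges = \<C>\<rparr>)
               \<le> ?\<gamma> (real n) * real (card \<C>) / real m * (?\<tau> (real n) (real m) / real m) ^ (i - 1))"
          unfolding card_hedges_expansion l_def[symmetric]
        proof (rule spread_copies_of_expansion[where H = H and F = F and t = "\<tau> (real n)" and M = "M (real n)"
              and g = "\<gamma> (real n)" and a = "A (real n) (real m)" and C = C and K = K and r = r,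
              unfolded H(2,3), folded l_def v_def, OF assms(1) _ _ tree sub K_def C(1-4) H(1)])
          show "2 \<le> r" "1 \<le> l" using assms(2,3) by (auto simp: l_def)
          show "3 \<le> n" using elim(5) .
          show "C * real n ^ (r - 1) \<le> real m" using H(4) .
          show "0 < M (real n)" using elim(2) by blast
          show "1 \<le> \<gamma> (real n)" by (rule \<gamma>)
          show "real m / real n ^ (r - 1) \<le> A (real n) (real m)"
            "A (real n) (real m) \<le> real m / (M (real n) * (C * ln (real n)))"
            using P[OF H(4)] powr by auto
          show "0 < \<tau> (real n) x" if "M (real n) \<le> x" for x using elim(2) that by blast
          show "\<tau> (real n) y \<le> \<tau> (real n) x" if "M (real n) \<le> x" "x \<le> y" for x y
            using anti elim(4) that by (auto simp: monotone_on_def)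
        qed (rule bal_n)
      qed
    qed
    with positive show "balanced r ?M ?\<gamma> ?\<tau> (expansion F)" unfolding balanced_def by blast
  qed
qed

end
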